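(* Let $1\le m\le n$ and let $f\in W^{1,m}(\mathbb{R}^n;\mathbb{R}^m)$ be Hölder continuous, with graph mapping $\bar f:\mathbb{R}^n\to\mathbb{R}^{n+m}$, $\bar f(x)=(x,f(x))$. If $N\subset\mathbb{R}^n$ and $\mathcal{L}^n(N)=0$, then $\mathcal{H}^n(P_V\circ\bar f(N))=0$ for every $V\in\mathbf{G}(n+m,n)$.
   Context: $\mathbf{G}(n+m,n)$ is the set of $n$-dimensional linear subspaces of $\mathbb{R}^{n+m}$, and $P_V:\mathbb{R}^{n+m}\to V$ is the orthogonal projection onto $V$. $\mathcal{H}^n$ is $n$-dimensional Hausdorff measure. *)

theory Defs
  imports "HOL-Analysis.Analysis"
begin

definition hausdorff_pre :: "nat \<Rightarrow> real \<Rightarrow> 'a::metric_space set \<Rightarrow> ennreal" where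
  "hausdorff_pre s \<delta> A =
     (INF C \<in> {C :: nat \<Rightarrow> 'a set. A \<subseteq> (\<Union>i. C i) \<and> (\<forall>i. bounded (C i) \<and> diameter (C i) \<le> \<delta>)}.
        (\<Sum>i. ennreal (unit_ball_vol (real s) * (diameter (C i) / 2) ^ s)))"

definition hausdorff_measure :: "nat \<Rightarrow> 'a::metric_space set \<Rightarrow> ennreal" where
  "hausdorff_measure s A = (SUP \<delta> \<in> {0<..}. hausdorff_pre s \<delta> A)"

definition grassmannian :: "nat \<Rightarrow> 'a::euclidean_space set set" where
  "grassmannian k = {V. subspace V \<and> dim V = k}"

definition orth_proj :: "'a::euclidean_space set \<Rightarrow> 'a \<Rightarrow> 'a" where
  "orth_proj V x = (THE v. v \<in> V \<and> (\<forall>w\<in>V. (x - v) \<bullet> w = 0))"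

fun iter_deriv :: "('a::real_normed_vector \<Rightarrow> real) \<Rightarrow> 'a list \<Rightarrow> 'a \<Rightarrow> real" where
  "iter_deriv \<phi> [] = \<phi>"
| "iter_deriv \<phi> (v # vs) = (\<lambda>x. frechet_derivative (iter_deriv \<phi> vs) (at x) v)"

definition smooth_fun :: "('a::real_normed_vector \<Rightarrow> real) \<Rightarrow> bool" where
  "smooth_fun \<phi> \<longleftrightarrow> (\<forall>vs x. iter_deriv \<phi> vs differentiable (at x))"

definition test_function :: "('a::euclidean_space \<Rightarrow> real) \<Rightarrow> bool" where
  "test_function \<phi> \<longleftrightarrow> smooth_fun \<phi> \<and> compact (closure {x. \<phi> x \<noteq> 0})"

definition partial_deriv :: "('n::finite) \<Rightarrow> (real^'n \<Rightarrow> real) \<Rightarrow> real^'n \<Rightarrow> real" where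
  "partial_deriv i \<phi> x = frechet_derivative \<phi> (at x) (axis i 1)"

definition Lp_space :: "nat \<Rightarrow> (real^'n::finite \<Rightarrow> 'b::euclidean_space) \<Rightarrow> bool" where
  "Lp_space p g \<longleftrightarrow> g \<in> borel_measurable lebesgue \<and> integrable lebesgue (\<lambda>x. norm (g x) ^ p)"

definition weak_partial :: "'n::finite \<Rightarrow> (real^'n \<Rightarrow> 'b::euclidean_space) \<Rightarrow> (real^'n \<Rightarrow> 'b) \<Rightarrow> bool" where
  "weak_partial i f g \<longleftrightarrow>
     (\<forall>\<phi>. test_function \<phi> \<longrightarrow>
        integral\<^sup>L lebesgue (\<lambda>x. partial_deriv i \<phi> x *\<^sub>R f x)
          = - integral\<^sup>L lebesgue (\<lambda>x. \<phi> x *\<^sub>R g x))"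

definition sobolev_1 :: "nat \<Rightarrow> (real^'n::finite \<Rightarrow> real^'k::finite) \<Rightarrow> bool" where
  "sobolev_1 p f \<longleftrightarrow> Lp_space p f \<and> (\<forall>i. \<exists>g. Lp_space p g \<and> weak_partial i f g)"

definition holder_continuous :: "('a::metric_space \<Rightarrow> 'b::metric_space) \<Rightarrow> bool" where
  "holder_continuous f \<longleftrightarrow>
     (\<exists>\<alpha> C. 0 < \<alpha> \<and> \<alpha> \<le> 1 \<and> (\<forall>x y. dist (f x) (f y) \<le> C * dist x y powr \<alpha>))"

end

(* The graph of f over N is itself H^n-null; the projection P_V, being 1-Lipschitz, then preserves
   this.

   Write mu(E) for the integral over E of 1 + sum_i |d_i f|^m. It suffices to cover the graph over any
   dyadic cube Q of side l by finitely many sets of diameter at most a constant times l whose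
   n-th powers of diameters add up to at most C mu(Q): decompose an open set G containing N, with
   mu(G) small, into dyadic cubes.

   Covering the graph over Q by dyadic cells, a greedy form of Frostman's lemma produces a finite
   measure sigma on points of Q that gives each cell of side r mass at most r^n, and whose total mass
   is the sum of r^n over a cover by cells; so sigma(Q) <= C mu(Q) has to be shown. Let Q_k be the
   dyadic cube of side 2^-k around x, f_k a smooth average of f over Q_k, and c_k = |f(x) - f_k|.
   Poincare's inequality gives |f_k - f_{k+1}|^m <= C 2^{k(n-m)} mu(Q_k). The maximal
   cubes with sigma(Q_k) <= Lambda mu(Q_k) have total mass at most Lambda mu(Q), so consider points
   all of whose cubes satisfy the reverse inequality. As long as c_k^m > e 2^{k(n-m)} sigma(Q_k), the number c_{k+1} is at least
   (1 - gamma) c_k; the remaining points carry only a small portion of the mass of Q_k by the Frostman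
   condition. Hence the sigma-mean of log max(c_k^m, e 2^{k(n-m)} sigma(Q_k)) decreases slowly with k,
   which contradicts the Hoelder bound c_k <= C 2^{-alpha k}. *)

theory Submission
  imports Defs
begin

subsection \<open>Nested partitions and saturating weights\<close>

text \<open>The exponent m is critical: the increments |f_k - f_{k+1}| come with no geometric gain,
  so they cannot be summed over the scales. They are therefore compared with the current deviation
  c_k. An increment of at most gamma c_k costs only -m log(1 - gamma) in the logarithm of c_k^m, and
  a small constant loss per scale cannot keep up with the decay alpha m log 2 per scale that Hoelder
  continuity forces. This is why every positive alpha suffices.

  The delicate loss occurs at points where the mass term dominates: passing to a child cube of tiny
  mass costs log(sigma(Q_k)/sigma(Q_{k+1})), which is unbounded. Bounding log x by 2 sqrt x makes
  its sigma-mean small, because the square root lets two bounds for the mass of such points share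
  the work: the mass of the child and the Frostman bound.

  The constants are chosen in the order gamma, e, Lambda, all independent of the cube; only the
  finest level K depends on its size. With K fixed, sigma is a weight on finitely many points and no
  limit of measures is taken.\<close>

definition dkey :: "nat \<Rightarrow> real^'k::finite \<Rightarrow> 'k \<Rightarrow> int" where
  "dkey k x = (\<lambda>i. \<lfloor>2 ^ k * x $ i\<rfloor>)"

text \<open>Keys are integers so that nesting of dyadic cubes becomes integer division by 2: the
  floor of t is the floor of 2 t, halved and rounded down.\<close>

lemma dkey_Suc:
  fixes x y :: "real^'k::finite"
  assumes "dkey (Suc k) x = dkey (Suc k) y"
  shows "dkey k x = dkey k y"
proof
  fix i
  have *: "\<lfloor>2 ^ k * z $ i\<rfloor> = \<lfloor>2 ^ Suc k * z $ i\<rfloor> div 2" for z :: "real^'k"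
    using floor_divide_real_eq_div[of 2 "2 ^ Suc k * z $ i"] by simp
  show "dkey k x i = dkey k y i"
    using fun_cong[OF assms, of i] *[of x] *[of y] by (simp add: dkey_def)
qed

text \<open>Stopping-time selections are needed for two nested families: dyadic cubes in the domain,
  and dyadic cells of the graph, whose key is a pair. Both are instances of this locale.\<close>

locale nested_keys =
  fixes \<kappa> :: "nat \<Rightarrow> 'p \<Rightarrow> 'z"
  assumes nested_Suc: "\<kappa> (Suc k) x = \<kappa> (Suc k) y \<Longrightarrow> \<kappa> k x = \<kappa> k y"
begin

lemma nested: "j \<le> k \<Longrightarrow> \<kappa> k x = \<kappa> k y \<Longrightarrow> \<kappa> j x = \<kappa> j y"
  by (induction rule: inc_induct) (auto intro: nested_Suc)

definition stop :: "(nat \<Rightarrow> 'p \<Rightarrow> bool) \<Rightarrow> 'p \<Rightarrow> nat" where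
  "stop R x = (LEAST k. R k x)"

text \<open>When \<open>R\<close> depends only on the cell, this is the largest cell around
  \<open>x\<close> on which \<open>R\<close> holds. If \<open>R\<close> holds at no level,
  \<open>stop\<close> is an unspecified number, hence the assumption \<open>R k x\<close>
  below.\<close>

definition stop_cell :: "(nat \<Rightarrow> 'p \<Rightarrow> bool) \<Rightarrow> 'p \<Rightarrow> 'p set" where
  "stop_cell R x = {y. \<kappa> (stop R x) y = \<kappa> (stop R x) x}"

context
  fixes R :: "nat \<Rightarrow> 'p \<Rightarrow> bool"
  assumes R_cong: "\<And>k x y. \<kappa> k x = \<kappa> k y \<Longrightarrow> R k x \<Longrightarrow> R k y"
begin

text \<open>Sharing the key at the stopping level of \<open>x\<close> transfers \<open>R\<close> to
  \<open>y\<close>, so \<open>y\<close> stops no later. By nesting the two points then also share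
  the key at the level where \<open>y\<close> stops, so \<open>x\<close> stops no later than
  \<open>y\<close>.\<close>

lemma stop_eq:
  assumes "R k x" "y \<in> stop_cell R x"
  shows "stop R y = stop R x"
proof -
  have eq: "\<kappa> (stop R x) y = \<kappa> (stop R x) x"
    using assms(2) by (simp add: stop_cell_def)
  have Rx: "R (stop R x) x"
    using assms(1) unfolding stop_def by (rule LeastI)
  then have Ry: "R (stop R x) y"
    using R_cong eq by metis
  then have "stop R y \<le> stop R x" "R (stop R y) y"
    unfolding stop_def by (auto intro: Least_le LeastI)
  moreover from this have "R (stop R y) x"
    using R_cong nested eq by metis
  then have "stop R x \<le> stop R y"
    unfolding stop_def by (rule Least_le)
  ultimately show ?thesis by simp
qed

lemma stop_cell_eq:
  assumes "R k x" "y \<in> stop_cell R x"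
  shows "stop_cell R y = stop_cell R x"
  using stop_eq[OF assms] assms(2) by (simp add: stop_cell_def)

lemma disjoint_stop_cells: "disjoint (stop_cell R ` {x. \<exists>k. R k x})"
  unfolding disjoint_def
proof (intro ballI impI)
  fix A B assume "A \<in> stop_cell R ` {x. \<exists>k. R k x}" "B \<in> stop_cell R ` {x. \<exists>k. R k x}" "A \<noteq> B"
  then show "A \<inter> B = {}"
    using stop_cell_eq by (smt (verit, best) disjoint_iff imageE mem_Collect_eq)
qed

end

lemma self_mem_stop_cell: "x \<in> stop_cell R x"
  by (simp add: stop_cell_def)

end

text \<open>The greedy construction behind Frostman's lemma: points are added one at a time, each
  with the largest weight that the capacities still permit. A saturated set stays saturated, since
  its sum can neither decrease nor exceed the capacity.\<close>

lemma saturating_weights: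
  fixes cap :: "'d \<Rightarrow> real" and mem :: "'d \<Rightarrow> 'p set"
  assumes "finite P" "finite D" "\<And>d. d \<in> D \<Longrightarrow> 0 \<le> cap d" "\<And>p. p \<in> P \<Longrightarrow> \<exists>d\<in>D. p \<in> mem d"
  shows "\<exists>w. (\<forall>p. 0 \<le> w p) \<and> (\<forall>d\<in>D. sum w (P \<inter> mem d) \<le> cap d) \<and>
             (\<forall>p\<in>P. \<exists>d\<in>D. p \<in> mem d \<and> sum w (P \<inter> mem d) = cap d)"
  using assms(1,4)
proof (induction rule: finite_induct)
  case empty
  show ?case using assms(3) by (intro exI[of _ "\<lambda>_. 0"]) auto
next
  case (insert q P)
  then obtain w where w: "\<forall>p. 0 \<le> w p" "\<forall>d\<in>D. sum w (P \<inter> mem d) \<le> cap d"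
    "\<forall>p\<in>P. \<exists>d\<in>D. p \<in> mem d \<and> sum w (P \<inter> mem d) = cap d" by auto
  define slack where "slack d = cap d - sum w (P \<inter> mem d)" for d
  define Dq where "Dq = {d\<in>D. q \<in> mem d}"
  have Dq: "finite (slack ` Dq)" "slack ` Dq \<noteq> {}"
    using assms(2) insert.prems by (auto simp: Dq_def)
  \<comment> \<open>The least slack among the sets that contain \<open>q\<close>; the set attaining
    the minimum becomes saturated.\<close>
  define t where "t = Min (slack ` Dq)"
  obtain d0 where d0: "d0 \<in> D" "q \<in> mem d0" "slack d0 = t"
    using Min_in[OF Dq] unfolding t_def Dq_def by auto
  have t_le: "t \<le> slack d" if "d \<in> D" "q \<in> mem d" for d
    using that Dq unfolding t_def by (intro Min_le) (auto simp: Dq_def)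
  have t0: "0 \<le> t" using d0 w(2) by (auto simp: slack_def)
  define v where "v = w(q := t)"
  have vP: "sum v (P \<inter> X) = sum w (P \<inter> X)" for X
    using insert.hyps by (intro sum.cong) (auto simp: v_def)
  have vq: "sum v (insert q P \<inter> X) = (if q \<in> X then t + sum w (P \<inter> X) else sum w (P \<inter> X))" for X
    using insert.hyps vP[of X] by (auto simp: Int_insert_left v_def)
  have 1: "\<forall>d\<in>D. sum v (insert q P \<inter> mem d) \<le> cap d"
  proof
    fix d assume "d \<in> D"
    then show "sum v (insert q P \<inter> mem d) \<le> cap d"
      using w(2) t_le[of d] by (auto simp: vq slack_def)
  qed
  have 2: "\<forall>p\<in>insert q P. \<exists>d\<in>D. p \<in> mem d \<and> sum v (insert q P \<inter> mem d) = cap d"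
  proof
    fix p assume "p \<in> insert q P"
    show "\<exists>d\<in>D. p \<in> mem d \<and> sum v (insert q P \<inter> mem d) = cap d"
    proof (cases "p = q")
      case True
      then show ?thesis using d0 by (intro bexI[of _ d0]) (auto simp: vq slack_def simp del: Int_insert_left_if1)
    next
      case False
      then obtain d where d: "d\<in>D" "p \<in> mem d" "sum w (P \<inter> mem d) = cap d"
        using w(3) \<open>p \<in> insert q P\<close> by auto
      have "sum v (insert q P \<inter> mem d) = cap d"
        using 1 d t0 by (force simp: vq)
      then show ?thesis using d by blast
    qed
  qed
  show ?case using 1 2 t0 w(1) by (intro exI[of _ v]) (auto simp: v_def)
qed

subsection \<open>Dyadic mass estimate\<close>

definition dcube :: "nat \<Rightarrow> real^'k::finite \<Rightarrow> (real^'k) set" where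
  "dcube k x = {y. dkey k y = dkey k x}"

interpretation dyadic: nested_keys "dkey :: nat \<Rightarrow> real^'k::finite \<Rightarrow> 'k \<Rightarrow> int"
  by unfold_locales (rule dkey_Suc)

lemma dcube_self [simp]: "x \<in> dcube k x"
  by (simp add: dcube_def)

lemma dcube_eq: "y \<in> dcube k x \<Longrightarrow> dcube k y = dcube k x"
  by (simp add: dcube_def)

lemma dcube_antimono: "j \<le> k \<Longrightarrow> dcube k x \<subseteq> dcube j x"
  by (auto simp: dcube_def intro: dyadic.nested)

lemma dyadic_stop_cell: "dyadic.stop_cell R x = dcube (dyadic.stop R x) x"
  by (simp add: dyadic.stop_cell_def dcube_def)

text \<open>A coordinate of a child's key is twice the parent's coordinate, or one more.\<close>

lemma finite_children:
  fixes x :: "real^'k::finite"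
  shows "finite (dkey (Suc k) ` dcube k x)" "card (dkey (Suc k) ` dcube k x) \<le> 2 ^ CARD('k)"
proof -
  let ?F = "PiE UNIV (\<lambda>i. {2 * dkey k x i, 2 * dkey k x i + 1})"
  have sub: "dkey (Suc k) ` dcube k x \<subseteq> ?F"
  proof (clarsimp simp: dcube_def PiE_UNIV_domain)
    fix y i assume "dkey k y = dkey k x" "dkey (Suc k) y i \<noteq> 2 * dkey k x i"
    moreover have "dkey k y i = dkey (Suc k) y i div 2"
      using floor_divide_real_eq_div[of 2 "2 ^ Suc k * y $ i"] by (simp add: dkey_def)
    ultimately show "dkey (Suc k) y i = 2 * dkey k x i + 1"
      by presburger
  qed
  have fin: "finite ?F" by (intro finite_PiE) auto
  then show "finite (dkey (Suc k) ` dcube k x)" using sub by (rule finite_subset[rotated])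
  have "card (dkey (Suc k) ` dcube k x) \<le> card ?F" by (rule card_mono[OF fin sub])
  also have "\<dots> = 2 ^ CARD('k)" by (subst card_PiE) (auto simp: numeral_2_eq_2)
  finally show "card (dkey (Suc k) ` dcube k x) \<le> 2 ^ CARD('k)" .
qed

text \<open>In each coordinate fewer than 2 r 2^k + 2 integers are possible; r 2^k >= 1 absorbs the
  summand 2 into the constant 4.\<close>

lemma keys_meeting_cball:
  fixes y :: "real^'k::finite"
  assumes r: "(1/2) ^ k \<le> r"
  shows "finite (dkey k ` cball y r)" "real (card (dkey k ` cball y r)) \<le> (4 * r * 2 ^ k) ^ CARD('k)"
proof -
  let ?F = "PiE UNIV (\<lambda>i. {\<lfloor>2 ^ k * (y $ i - r)\<rfloor>..\<lfloor>2 ^ k * (y $ i + r)\<rfloor>})"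
  have sub: "dkey k ` cball y r \<subseteq> ?F"
  proof (clarsimp simp: dkey_def PiE_UNIV_domain)
    fix z i assume "dist y z \<le> r"
    then have "\<bar>y $ i - z $ i\<bar> \<le> r"
      using component_le_norm_cart[of "y - z" i] by (simp add: dist_norm)
    then show "\<lfloor>2 ^ k * (y $ i - r)\<rfloor> \<le> \<lfloor>2 ^ k * z $ i\<rfloor> \<and> \<lfloor>2 ^ k * z $ i\<rfloor> \<le> \<lfloor>2 ^ k * (y $ i + r)\<rfloor>"
      by (intro conjI floor_mono mult_left_mono) auto
  qed
  have fin: "finite ?F" by (intro finite_PiE) auto
  then show "finite (dkey k ` cball y r)" using sub by (rule finite_subset[rotated])
  have r1: "1 \<le> r * 2 ^ k"
    using mult_right_mono[OF r, of "2^k"] by (simp add: power_one_over)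
  have le: "real (card {\<lfloor>2 ^ k * (t - r)\<rfloor>..\<lfloor>2 ^ k * (t + r)\<rfloor>}) \<le> 4 * r * 2 ^ k" for t
  proof -
    have "real_of_int (\<lfloor>2 ^ k * (t + r)\<rfloor> + 1 - \<lfloor>2 ^ k * (t - r)\<rfloor>) \<le> 4 * r * 2 ^ k"
    proof -
      have "2 ^ k * (t + r) - 2 ^ k * (t - r) = 2 * (r * 2 ^ k)" by (simp add: algebra_simps)
      then show ?thesis
        using r1 of_int_floor_le[of "2 ^ k * (t + r)"] real_of_int_floor_gt_diff_one[of "2 ^ k * (t - r)"]
        by linarith
    qed
    then show ?thesis using r1 by simp
  qed
  have "real (card (dkey k ` cball y r)) \<le> real (card ?F)" using card_mono[OF fin sub] by simp
  also have "\<dots> = (\<Prod>i\<in>UNIV. real (card {\<lfloor>2 ^ k * (y $ i - r)\<rfloor>..\<lfloor>2 ^ k * (y $ i + r)\<rfloor>}))"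
    by (subst card_PiE) auto
  also have "\<dots> \<le> (\<Prod>i\<in>(UNIV::'k set). 4 * r * 2 ^ k)"
    by (intro prod_mono conjI le) auto
  finally show "real (card (dkey k ` cball y r)) \<le> (4 * r * 2 ^ k) ^ CARD('k)" by simp
qed

text \<open>The interface between analysis and combinatorics. \<open>avg_close\<close> carries
  Hoelder continuity, \<open>avg_step\<close> is the scaled Poincare inequality between consecutive
  levels, and \<open>\<mu>\<close> will be the measure with density 1 + sum_i |d_i f|^m, the summand
  1 being responsible for \<open>\<mu>_ge\<close>.\<close>

locale dyadic_telescope =
  fixes f :: "real^'n::finite \<Rightarrow> real^'m::finite"
    and avg :: "nat \<Rightarrow> real^'n \<Rightarrow> real^'m"
    and \<mu> :: "(real^'n) set \<Rightarrow> real"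
    and \<alpha> C1 C2 :: real
  assumes card_le: "CARD('m) \<le> CARD('n)"
    and \<alpha>: "0 < \<alpha>" "\<alpha> \<le> 1" and C1: "1 \<le> C1" and C2: "0 < C2"
    and avg_cong: "\<And>k x y. y \<in> dcube k x \<Longrightarrow> avg k y = avg k x"
    and avg_close: "\<And>k x. norm (f x - avg k x) \<le> C1 * 2 powr (- \<alpha> * k)"
    and avg_step: "\<And>k x. norm (avg k x - avg (Suc k) x) ^ CARD('m)
                     \<le> C2 * 2 ^ (k * (CARD('n) - CARD('m))) * \<mu> (dcube k x)"
    and \<mu>_ge: "\<And>k x. (1/2) ^ (k * CARD('n)) \<le> \<mu> (dcube k x)"
    and \<mu>_sum: "\<And>\<D> k x. finite \<D> \<Longrightarrow> disjoint \<D> \<Longrightarrow> \<D> \<subseteq> range (case_prod dcube) \<Longrightarrow>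
                  \<Union>\<D> \<subseteq> dcube k x \<Longrightarrow> (\<Sum>D\<in>\<D>. \<mu> D) \<le> \<mu> (dcube k x)"

text \<open>\<open>cell_mass\<close> is the Frostman condition on the levels from \<open>k0\<close>
  to \<open>K\<close>. \<open>\<gamma>\<close> is the relative drop of \<open>c\<close> tolerated
  per level, \<open>e\<close> the weight of the mass term in the potential \<open>v\<close>, and
  \<open>\<Lambda>\<close> the density at which a cube is stopped. The second condition on
  \<open>\<Lambda>\<close> makes the increment of the averages at most \<open>\<gamma>\<close> times
  the deviation.\<close>

locale dyadic_mass = dyadic_telescope f avg \<mu> \<alpha> C1 C2
  for f :: "real^'n::finite \<Rightarrow> real^'m::finite" and avg \<mu> \<alpha> C1 C2 +
  fixes P :: "(real^'n) set" and w :: "real^'n \<Rightarrow> real" and k0 K :: nat and x0 :: "real^'n"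
    and \<gamma> e \<Lambda> :: real
  assumes finP: "finite P" and w_nonneg: "\<And>p. 0 \<le> w p" and P_sub: "P \<subseteq> dcube k0 x0"
    and k0K: "k0 \<le> K"
    and cell_mass: "\<And>k p. k0 \<le> k \<Longrightarrow> k \<le> K \<Longrightarrow> p \<in> P \<Longrightarrow>
          sum w {q\<in>P. dkey k q = dkey k p \<and> dkey k (f q) = dkey k (f p)} \<le> (1/2) ^ (k * CARD('n))"
    and \<gamma>: "0 < \<gamma>" "\<gamma> < 1" and e: "0 < e" "4 ^ CARD('m) * e \<le> 1"
    and \<Lambda>: "1 \<le> e * \<Lambda>" "C2 \<le> e * \<Lambda> * \<gamma> ^ CARD('m)"
begin

definition S :: "nat \<Rightarrow> real^'n \<Rightarrow> real" where "S k p = sum w (P \<inter> dcube k p)"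
text \<open>The factor that turns a mass of order side^n on a cube of level \<open>k\<close> into
  side^m, the scale of \<open>c k p ^ CARD('m)\<close>. The subtraction does not truncate, by
  \<open>card_le\<close>.\<close>

definition D :: "nat \<Rightarrow> real" where "D k = 2 ^ (k * (CARD('n) - CARD('m)))"
definition c :: "nat \<Rightarrow> real^'n \<Rightarrow> real" where "c k p = norm (f p - avg k p)"
definition v :: "nat \<Rightarrow> real^'n \<Rightarrow> real" where "v k p = max (c k p ^ CARD('m)) (e * S k p * D k)"
definition U :: "(real^'n) set" where
  "U = {p\<in>P. \<forall>k\<in>{k0..K}. \<Lambda> * \<mu> (dcube k p) < S k p}"
text \<open>The points where the mass term decides the maximum in \<open>v\<close>. Their values
  under f lie so close to the average that the Frostman condition makes them rare.\<close>

definition good :: "nat \<Rightarrow> (real^'n) set" where "good k = {p\<in>U. c k p ^ CARD('m) \<le> e * S k p * D k}"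

lemma D_pos: "0 < D k" by (simp add: D_def)

lemma \<mu>_pos: "0 < \<mu> (dcube k x)"
  using \<mu>_ge[of k x] by (rule less_le_trans[rotated]) simp

lemma \<Lambda>_pos: "0 < \<Lambda>"
  using \<Lambda>(1) e(1) by (smt (verit) mult_nonneg_nonpos)

lemma D_scale: "(1/2) ^ (k * CARD('n)) * D k = ((1/2::real) ^ k) ^ CARD('m)"
proof -
  have "k * CARD('n) = k * CARD('m) + k * (CARD('n) - CARD('m))"
    using card_le by (metis add_mult_distrib2 le_add_diff_inverse)
  then show ?thesis
    by (simp add: D_def power_add power_mult[symmetric] power_one_over)
qed

lemma S_cong: "q \<in> dcube k p \<Longrightarrow> S k q = S k p"
  by (simp add: S_def dcube_eq)

lemma S_U: "p \<in> U \<Longrightarrow> k0 \<le> k \<Longrightarrow> k \<le> K \<Longrightarrow> \<Lambda> * \<mu> (dcube k p) < S k p"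
  by (auto simp: U_def)

lemma S_pos: "p \<in> U \<Longrightarrow> k0 \<le> k \<Longrightarrow> k \<le> K \<Longrightarrow> 0 < S k p"
  using S_U[of p k] \<mu>_pos[of k p] \<Lambda>_pos by (smt (verit) mult_pos_pos)

text \<open>An unstopped cube has mass above \<open>\<Lambda>\<close> times its volume, and
  \<open>1 \<le> e * \<Lambda>\<close>. Hence the radius whose m-th power is the mass term is at
  least the side of a cell, as \<open>ball_mass\<close> requires; at level \<open>k0\<close> this
  also bounds \<open>v\<close> from below.\<close>

lemma eSD_ge:
  assumes "p \<in> U" "k0 \<le> k" "k \<le> K"
  shows "((1/2) ^ k) ^ CARD('m) \<le> e * S k p * D k"
proof -
  have "((1/2::real) ^ k) ^ CARD('m) = 1 * (1/2) ^ (k * CARD('n)) * D k" using D_scale by simp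
  also have "\<dots> \<le> (e * \<Lambda>) * \<mu> (dcube k p) * D k"
    using \<mu>_ge[of k p] \<Lambda>(1) D_pos[of k] by (intro mult_right_mono mult_mono) auto
  also have "\<dots> = e * (\<Lambda> * \<mu> (dcube k p)) * D k" by simp
  also have "\<dots> \<le> e * S k p * D k"
    using S_U[OF assms] e D_pos[of k] by (intro mult_right_mono mult_left_mono) auto
  finally show ?thesis .
qed

text \<open>The ball of radius \<open>r\<close> meets at most (4 r 2^k)^m dyadic cubes of the
  target, and together with the cube around \<open>p\<close> each of them forms a cell of mass at
  most 2^(-kn).\<close>

lemma ball_mass:
  assumes "k0 \<le> k" "k \<le> K" "(1/2) ^ k \<le> r"
  shows "sum w {q\<in>P \<inter> dcube k p. norm (f q - y) \<le> r} * D k \<le> 4 ^ CARD('m) * r ^ CARD('m)"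
proof -
  define A where "A = {q\<in>P \<inter> dcube k p. norm (f q - y) \<le> r}"
  let ?g = "\<lambda>q. dkey k (f q)"
  have finA: "finite A" using finP by (simp add: A_def)
  have r0: "0 < r" using assms(3) by (smt (verit) zero_less_power zero_less_divide_1_iff)
  have im: "?g ` A \<subseteq> dkey k ` cball y r"
    by (auto simp: A_def dist_norm norm_minus_commute)
  have "sum w A = (\<Sum>u\<in>?g ` A. sum w {q\<in>A. ?g q = u})"
    by (rule sum.image_gen[OF finA])
  also have "\<dots> \<le> (\<Sum>u\<in>?g ` A. (1/2) ^ (k * CARD('n)))"
  proof (rule sum_mono)
    fix u assume "u \<in> ?g ` A"
    then obtain p' where p': "p' \<in> A" "u = ?g p'" by auto
    have "sum w {q\<in>A. ?g q = u} \<le> sum w {q\<in>P. dkey k q = dkey k p' \<and> dkey k (f q) = dkey k (f p')}"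
      using p' finP w_nonneg by (intro sum_mono2) (auto simp: A_def dcube_def)
    also have "\<dots> \<le> (1/2) ^ (k * CARD('n))" using p' assms by (intro cell_mass) (auto simp: A_def)
    finally show "sum w {q\<in>A. ?g q = u} \<le> (1/2) ^ (k * CARD('n))" .
  qed
  also have "\<dots> = real (card (?g ` A)) * (1/2) ^ (k * CARD('n))" by simp
  also have "\<dots> \<le> (4 * r * 2 ^ k) ^ CARD('m) * (1/2) ^ (k * CARD('n))"
    using card_mono[OF keys_meeting_cball(1)[OF assms(3)] im] keys_meeting_cball(2)[OF assms(3), of y]
    by (intro mult_right_mono) auto
  finally have "sum w A * D k \<le> (4 * r * 2 ^ k) ^ CARD('m) * ((1/2) ^ (k * CARD('n)) * D k)"
    using D_pos[of k] by (simp add: mult.assoc[symmetric])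
  also have "\<dots> = 4 ^ CARD('m) * r ^ CARD('m)"
    by (subst D_scale) (simp add: power_mult_distrib power_one_over)
  finally show ?thesis by (simp add: A_def)
qed

text \<open>A point of \<open>P\<close> outside \<open>U\<close> lies in a first cube that violates
  the reverse inequality. These maximal cubes are disjoint and stay inside
  \<open>dcube k0 x0\<close>, so their bounds add up by \<open>\<mu>_sum\<close>.\<close>

lemma stopped_mass: "sum w (P - U) \<le> \<Lambda> * \<mu> (dcube k0 x0)"
proof -
  define R where "R k p \<longleftrightarrow> k0 \<le> k \<and> k \<le> K \<and> S k p \<le> \<Lambda> * \<mu> (dcube k p)" for k p
  have R_cong: "R k y" if "dkey k x = dkey k y" "R k x" for k x y
    using that S_cong[of y k x] dcube_eq[of y k x] by (auto simp: R_def dcube_def)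
  have ex: "\<exists>k. R k p" if "p \<in> P - U" for p using that by (force simp: U_def R_def)
  have R_stop: "R (dyadic.stop R p) p" if "p \<in> P - U" for p
    using ex[OF that] unfolding dyadic.stop_def by (rule LeastI_ex)
  let ?\<C> = "dyadic.stop_cell R ` (P - U)"
  have fin: "finite ?\<C>" using finP by simp
  have disj: "disjoint ?\<C>"
  proof -
    have "disjoint (dyadic.stop_cell R ` {x. \<exists>k. R k x})"
      using R_cong by (intro dyadic.disjoint_stop_cells) blast
    moreover have "?\<C> \<subseteq> dyadic.stop_cell R ` {x. \<exists>k. R k x}" using ex by auto
    ultimately show ?thesis by (rule pairwise_subset)
  qed
  have sub: "\<Union>?\<C> \<subseteq> dcube k0 x0"
  proof
    fix y assume "y \<in> \<Union>?\<C>"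
    then obtain p where p: "p \<in> P - U" "y \<in> dcube (dyadic.stop R p) p" by (auto simp: dyadic_stop_cell)
    then have "y \<in> dcube k0 p" using R_stop[OF p(1)] dcube_antimono by (auto simp: R_def)
    moreover have "dcube k0 p = dcube k0 x0" using p P_sub by (intro dcube_eq) auto
    ultimately show "y \<in> dcube k0 x0" by simp
  qed
  have "sum w (P - U) \<le> sum w (\<Union>C\<in>?\<C>. P \<inter> C)"
    using finP w_nonneg dyadic.self_mem_stop_cell by (intro sum_mono2) auto
  also have "\<dots> = (\<Sum>C\<in>?\<C>. sum w (P \<inter> C))"
    using fin finP disj by (intro sum.UNION_disjoint) (auto simp: disjoint_def)
  also have "\<dots> \<le> (\<Sum>C\<in>?\<C>. \<Lambda> * \<mu> C)"
  proof (rule sum_mono)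
    fix C assume "C \<in> ?\<C>"
    then obtain p where "p \<in> P - U" "C = dcube (dyadic.stop R p) p" by (auto simp: dyadic_stop_cell)
    then show "sum w (P \<inter> C) \<le> \<Lambda> * \<mu> C" using R_stop[of p] by (simp add: R_def S_def)
  qed
  also have "\<dots> = \<Lambda> * (\<Sum>C\<in>?\<C>. \<mu> C)" by (simp add: sum_distrib_left)
  also have "\<dots> \<le> \<Lambda> * \<mu> (dcube k0 x0)"
  proof -
    have "?\<C> \<subseteq> range (case_prod dcube)"
      by (auto simp: dyadic_stop_cell intro!: image_eqI[where x="(_, _)"])
    then show ?thesis
      using fin disj sub \<Lambda>_pos by (intro mult_left_mono \<mu>_sum) auto
  qed
  finally show ?thesis .
qed

lemma v_pos: "p \<in> U \<Longrightarrow> k0 \<le> k \<Longrightarrow> k \<le> K \<Longrightarrow> 0 < v k p"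
  using S_pos[of p k] e D_pos[of k] by (auto simp: v_def less_max_iff_disj)

text \<open>At a good point \<open>v\<close> equals its mass term and \<open>D\<close> increases
  with the level, so the ratio of potentials is at most the ratio of the masses of the two cubes. At
  any other point of \<open>U\<close> the chain C2, \<open>\<Lambda>\<close>, \<open>S\<close>,
  \<open>c\<close> bounds the increment of the averages by \<open>\<gamma> * c k p\<close>, and
  \<open>c\<close> loses at most the factor 1 - gamma.\<close>

lemma v_step:
  assumes p: "p \<in> U" and k: "k0 \<le> k" "Suc k \<le> K"
  shows "ln (v k p) - ln (v (Suc k) p)
         \<le> - (real CARD('m) * ln (1 - \<gamma>)) + (if p \<in> good k then 2 * sqrt (S k p / S (Suc k) p) else 0)"
proof -
  have pos: "0 < S k p" "0 < S (Suc k) p" "0 < v k p" "0 < v (Suc k) p"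
    using S_pos v_pos p k by auto
  have \<gamma>': "0 \<le> - (real CARD('m) * ln (1 - \<gamma>))" using \<gamma> by (simp add: mult_nonneg_nonpos)
  show ?thesis
  proof (cases "p \<in> good k")
    case True
    then have "v k p = e * S k p * D k" by (auto simp: good_def v_def)
    moreover have "e * S (Suc k) p * D k \<le> v (Suc k) p"
    proof -
      have "D k \<le> D (Suc k)" unfolding D_def by (intro power_increasing) auto
      then have "e * S (Suc k) p * D k \<le> e * S (Suc k) p * D (Suc k)"
        using pos e by (intro mult_left_mono) auto
      then show ?thesis by (simp add: v_def)
    qed
    ultimately have "v k p / v (Suc k) p \<le> (e * S k p * D k) / (e * S (Suc k) p * D k)"
      using pos e D_pos[of k] by (intro divide_mono) auto
    also have "\<dots> = S k p / S (Suc k) p" using e D_pos[of k] by simp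
    finally have "ln (v k p / v (Suc k) p) \<le> ln (S k p / S (Suc k) p)" using pos by simp
    \<comment> \<open>Using ln x <= x directly would lose: the weighted sum of the ratios themselves
      can be as large as the full mass. With the square root \<open>good_sum\<close> gains a small
      factor.\<close>
    also have "\<dots> = 2 * ln (sqrt (S k p / S (Suc k) p))" using pos by (simp add: ln_sqrt)
    also have "\<dots> \<le> 2 * sqrt (S k p / S (Suc k) p)"
      using pos by (intro mult_left_mono ln_bound) auto
    finally show ?thesis using True pos \<gamma>' by (simp add: ln_div)
  next
    case False
    then have big: "e * S k p * D k < c k p ^ CARD('m)" using p by (auto simp: good_def)
    have c0: "0 < c k p"
      using big pos e D_pos[of k] by (metis c_def norm_ge_zero order_less_le mult_pos_pos
          order_less_trans power_0_left zero_less_card_finite less_irrefl)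
    let ?d = "norm (avg k p - avg (Suc k) p)"
    have "?d ^ CARD('m) \<le> C2 * D k * \<mu> (dcube k p)" using avg_step by (simp add: D_def)
    also have "\<dots> \<le> (e * \<Lambda> * \<gamma> ^ CARD('m)) * D k * \<mu> (dcube k p)"
      using \<Lambda>(2) D_pos[of k] \<mu>_pos[of k p] by (intro mult_right_mono) auto
    also have "\<dots> = \<gamma> ^ CARD('m) * (e * (\<Lambda> * \<mu> (dcube k p)) * D k)" by simp
    also have "\<dots> \<le> \<gamma> ^ CARD('m) * (e * S k p * D k)"
      using S_U[of p k] p k e D_pos[of k] \<gamma> by (intro mult_left_mono mult_right_mono) auto
    also have "\<dots> \<le> \<gamma> ^ CARD('m) * c k p ^ CARD('m)" using big \<gamma> by (intro mult_left_mono) auto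
    also have "\<dots> = (\<gamma> * c k p) ^ CARD('m)" by (simp add: power_mult_distrib)
    finally have "?d \<le> \<gamma> * c k p"
      using c0 \<gamma> power_mono_iff[of ?d "\<gamma> * c k p" "CARD('m)"] by auto
    moreover have "c k p \<le> c (Suc k) p + ?d"
      using norm_triangle_ineq[of "f p - avg (Suc k) p" "avg (Suc k) p - avg k p"]
      by (simp add: c_def norm_minus_commute)
    ultimately have "(1 - \<gamma>) * c k p \<le> c (Suc k) p" by (simp add: algebra_simps)
    then have "((1 - \<gamma>) * c k p) ^ CARD('m) \<le> c (Suc k) p ^ CARD('m)"
      using c0 \<gamma> by (intro power_mono) auto
    also have "\<dots> \<le> v (Suc k) p" by (simp add: v_def)
    finally have "(1 - \<gamma>) ^ CARD('m) * v k p \<le> v (Suc k) p"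
      using big by (simp add: v_def power_mult_distrib)
    then have "ln ((1 - \<gamma>) ^ CARD('m) * v k p) \<le> ln (v (Suc k) p)"
      using pos \<gamma> by simp
    then show ?thesis using False pos \<gamma> by (simp add: ln_mult ln_realpow)
  qed
qed

text \<open>Within one child cube both masses are constant, so only the weight of its good points
  matters. Each child contributes at most sqrt(4^m e) times the mass of its parent, and a parent is
  counted once per child, at most 2^n times.\<close>

lemma good_sum:
  assumes k: "k0 \<le> k" "Suc k \<le> K"
  shows "(\<Sum>p\<in>good k. w p * sqrt (S k p / S (Suc k) p)) \<le> 2 ^ CARD('n) * sqrt (4 ^ CARD('m) * e) * sum w P"
proof -
  let ?G = "good k" and ?t = "sqrt (4 ^ CARD('m) * e)"
  have GU: "?G \<subseteq> U" and GP: "?G \<subseteq> P" by (auto simp: good_def U_def)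
  have finG: "finite ?G" using GP finP finite_subset by blast
  let ?key = "\<lambda>p. dkey (Suc k) p"
  have child: "(\<Sum>p\<in>{p\<in>?G. ?key p = ?key p'}. w p * sqrt (S k p / S (Suc k) p)) \<le> ?t * S k p'"
    if "p' \<in> ?G" for p'
  proof -
    let ?A = "{p\<in>?G. ?key p = ?key p'}"
    have pos: "0 < S k p'" "0 < S (Suc k) p'" using S_pos GU that k by auto
    have A: "p \<in> dcube (Suc k) p'" "p \<in> dcube k p'" if "p \<in> ?A" for p
      using that dyadic.nested_Suc[of k] by (auto simp: dcube_def)
    have "(\<Sum>p\<in>?A. w p * sqrt (S k p / S (Suc k) p)) = (\<Sum>p\<in>?A. w p * sqrt (S k p' / S (Suc k) p'))"
      using S_cong[OF A(1)] S_cong[OF A(2)] by (intro sum.cong) auto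
    also have "\<dots> = sum w ?A * sqrt (S k p' / S (Suc k) p')" by (simp add: sum_distrib_right)
    finally have eq: "(\<Sum>p\<in>?A. w p * sqrt (S k p / S (Suc k) p)) = sum w ?A * sqrt (S k p' / S (Suc k) p')" .
    have A0: "0 \<le> sum w ?A" using w_nonneg by (simp add: sum_nonneg)
    have A1: "sum w ?A \<le> S (Suc k) p'"
      unfolding S_def using A GP finP w_nonneg by (intro sum_mono2) auto
    \<comment> \<open>By definition of \<open>good\<close>, all good points of the parent cube have
      values within this distance of the average.\<close>
    define r where "r = root CARD('m) (e * S k p' * D k)"
    have rm: "r ^ CARD('m) = e * S k p' * D k" unfolding r_def
      using pos e D_pos[of k] by (intro real_root_pow_pos2) auto
    have r0: "0 \<le> r" unfolding r_def using pos e D_pos[of k] by auto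
    have "((1/2) ^ k) ^ CARD('m) \<le> r ^ CARD('m)" unfolding rm using that GU k by (intro eSD_ge) auto
    then have rk: "(1/2) ^ k \<le> r" using r0 power_mono_iff[of "(1/2)^k" r "CARD('m)"] by auto
    have sub: "?A \<subseteq> {q\<in>P \<inter> dcube k p'. norm (f q - avg k p') \<le> r}"
    proof
      fix q assume q: "q \<in> ?A"
      then have "norm (f q - avg k p') ^ CARD('m) \<le> r ^ CARD('m)"
        using A(2)[OF q] avg_cong[OF A(2)[OF q]] S_cong[OF A(2)[OF q]] rm by (simp add: good_def c_def)
      then have "norm (f q - avg k p') \<le> r"
        using r0 power_mono_iff[of "norm (f q - avg k p')" r "CARD('m)"] by auto
      then show "q \<in> {q\<in>P \<inter> dcube k p'. norm (f q - avg k p') \<le> r}"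
        using A(2)[OF q] q GP by auto
    qed
    have "sum w ?A * D k \<le> sum w {q\<in>P \<inter> dcube k p'. norm (f q - avg k p') \<le> r} * D k"
      using sub finP w_nonneg D_pos[of k] by (intro mult_right_mono sum_mono2) auto
    also have "\<dots> \<le> 4 ^ CARD('m) * r ^ CARD('m)" using k rk by (intro ball_mass) auto
    finally have A2: "sum w ?A \<le> 4 ^ CARD('m) * e * S k p'" using D_pos[of k] by (simp add: rm)
    \<comment> \<open>One square root of the weight of \<open>?A\<close> is bounded by the Frostman
      estimate \<open>A2\<close>, the other by the mass of the child, which cancels the
      denominator.\<close>
    have "sum w ?A * sqrt (S k p' / S (Suc k) p') =
        sqrt (sum w ?A) * sqrt (sum w ?A) * (sqrt (S k p') / sqrt (S (Suc k) p'))"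
      using A0 by (simp add: real_sqrt_divide)
    also have "\<dots> \<le> sqrt (4 ^ CARD('m) * e * S k p') * sqrt (S (Suc k) p') * (sqrt (S k p') / sqrt (S (Suc k) p'))"
      using A0 A1 A2 pos by (intro mult_right_mono mult_mono) auto
    also have "\<dots> = ?t * S k p'" using pos e by (simp add: real_sqrt_mult)
    finally show ?thesis by (simp add: eq)
  qed
  define par where "par z = (SOME p. p \<in> ?G \<and> ?key p = z)" for z
  have par: "par z \<in> ?G" "?key (par z) = z" if "z \<in> ?key ` ?G" for z
  proof -
    from that obtain p where "p \<in> ?G \<and> ?key p = z" by auto
    from someI[of "\<lambda>p. p \<in> ?G \<and> ?key p = z", OF this] show "par z \<in> ?G" "?key (par z) = z"
      by (auto simp: par_def)
  qed
  have "(\<Sum>p\<in>?G. w p * sqrt (S k p / S (Suc k) p))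
      = (\<Sum>z\<in>?key ` ?G. \<Sum>p\<in>{p\<in>?G. ?key p = z}. w p * sqrt (S k p / S (Suc k) p))"
    by (rule sum.image_gen[OF finG])
  also have "\<dots> \<le> (\<Sum>z\<in>?key ` ?G. ?t * S k (par z))"
  proof (rule sum_mono)
    fix z assume z: "z \<in> ?key ` ?G"
    show "(\<Sum>p\<in>{p\<in>?G. ?key p = z}. w p * sqrt (S k p / S (Suc k) p)) \<le> ?t * S k (par z)"
      using child[OF par(1)[OF z]] by (simp add: par(2)[OF z])
  qed
  also have "\<dots> = ?t * (\<Sum>z\<in>?key ` ?G. \<Sum>q\<in>P. if q \<in> dcube k (par z) then w q else 0)"
    using finP by (simp add: sum_distrib_left S_def sum.inter_restrict)
  also have "\<dots> = ?t * (\<Sum>q\<in>P. \<Sum>z\<in>?key ` ?G. if q \<in> dcube k (par z) then w q else 0)"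
    by (subst sum.swap) simp
  also have "\<dots> \<le> ?t * (\<Sum>q\<in>P. 2 ^ CARD('n) * w q)"
  proof (intro mult_left_mono sum_mono)
    fix q assume "q \<in> P"
    \<comment> \<open>The weight of \<open>q\<close> is counted once for each child of its level-k
      cube that contains good points.\<close>
    have sub: "{z\<in>?key ` ?G. q \<in> dcube k (par z)} \<subseteq> ?key ` dcube k q"
      using par by (fastforce simp: dcube_def intro!: rev_image_eqI)
    have "(\<Sum>z\<in>?key ` ?G. if q \<in> dcube k (par z) then w q else 0)
        = real (card {z\<in>?key ` ?G. q \<in> dcube k (par z)}) * w q"
      using finG by (subst sum.inter_filter[symmetric]) auto
    also have "\<dots> \<le> 2 ^ CARD('n) * w q"
    proof (intro mult_right_mono w_nonneg)
      have "card {z\<in>?key ` ?G. q \<in> dcube k (par z)} \<le> 2 ^ CARD('n)"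
        using card_mono[OF finite_children(1) sub] finite_children(2)[of k q] by (rule le_trans)
      then have "real (card {z\<in>?key ` ?G. q \<in> dcube k (par z)}) \<le> real (2 ^ CARD('n))"
        by (rule of_nat_mono)
      then show "real (card {z\<in>?key ` ?G. q \<in> dcube k (par z)}) \<le> 2 ^ CARD('n)"
        by (simp only: of_nat_power of_nat_numeral)
    qed
    finally show "(\<Sum>z\<in>?key ` ?G. if q \<in> dcube k (par z) then w q else 0) \<le> 2 ^ CARD('n) * w q" .
  qed (use e in auto)
  also have "\<dots> = 2 ^ CARD('n) * ?t * sum w P"
    unfolding sum_distrib_left[symmetric] by (simp add: mult_ac)
  finally show ?thesis .
qed

text \<open>\<open>small\<close> limits the mean loss of ln v per level to (alpha m ln 2)/4 times
  the total mass. If the bound failed, more than half of the mass would lie in \<open>U\<close>,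
  where by \<open>large\<close> the total loss exceeds half of alpha K m ln 2. With at most K levels
  the two halves and the quarter contradict each other.\<close>

lemma total_mass:
  assumes small: "- (real CARD('m) * ln (1 - \<gamma>)) + 2 * (2 ^ CARD('n) * sqrt (4 ^ CARD('m) * e)) \<le> \<alpha> * CARD('m) * ln 2 / 4"
    and large: "4 * (k0 * ln 2 + ln C1) < \<alpha> * K * ln 2"
  shows "sum w P \<le> 2 * \<Lambda> * \<mu> (dcube k0 x0)"
proof (rule ccontr)
  assume neg: "\<not> ?thesis"
  define h where "h = sum w P"
  have h0: "0 < h" using neg \<Lambda>_pos \<mu>_pos[of k0 x0] unfolding h_def
    by (smt (verit) mult_pos_pos)
  have UP: "U \<subseteq> P" by (auto simp: U_def)
  have finU: "finite U" using UP finP finite_subset by blast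
  have "h = sum w U + sum w (P - U)"
    unfolding h_def using UP finP by (subst sum.subset_diff[of U P]) auto
  \<comment> \<open>The negated claim says that twice the bound of \<open>stopped_mass\<close> is
    below \<open>h\<close>.\<close>
  then have hU: "h / 2 < sum w U" using stopped_mass neg by (simp add: h_def)
  define \<delta> where "\<delta> = - (real CARD('m) * ln (1 - \<gamma>))"
  have \<delta>0: "0 \<le> \<delta>" using \<gamma> by (simp add: mult_nonneg_nonpos \<delta>_def)
  define loss where "loss k p = \<delta> + (if p \<in> good k then 2 * sqrt (S k p / S (Suc k) p) else 0)" for k p
  \<comment> \<open>The drop forced on ln v between the levels: at \<open>k0\<close> the potential
    is at least 2^(-k0 m), at \<open>K\<close> at most (C1 2^(-alpha K))^m.\<close>
  define B where "B = \<alpha> * K * CARD('m) * ln 2 - CARD('m) * ln C1 - k0 * CARD('m) * ln 2"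
  have C1': "0 \<le> ln C1" using C1 by simp
  have low: "B \<le> ln (v k0 p) - ln (v K p)" if p: "p \<in> U" for p
  proof -
    have "((1/2::real) ^ k0) ^ CARD('m) \<le> v k0 p" using eSD_ge[OF p, of k0] k0K by (simp add: v_def)
    then have "ln (((1/2::real) ^ k0) ^ CARD('m)) \<le> ln (v k0 p)" using v_pos[OF p, of k0] k0K by simp
    then have 1: "- (k0 * CARD('m) * ln 2) \<le> ln (v k0 p)" by (simp add: ln_realpow ln_div mult_ac)
    define r where "r = C1 * 2 powr (- \<alpha> * K)"
    have r0: "0 < r" using C1 by (simp add: r_def)
    \<comment> \<open>Since \<open>\<alpha> \<le> 1\<close> and \<open>1 \<le> C1\<close>, the
      Hoelder radius is no smaller than the cells of level \<open>K\<close>. All of the cube lies in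
      the corresponding ball, so \<open>ball_mass\<close> controls the mass term, with
      \<open>4 ^ CARD('m) * e \<le> 1\<close> cancelling its constant.\<close>
    have "(1/2) ^ K = 2 powr (- real K)"
      by (simp add: powr_minus powr_realpow power_one_over inverse_eq_divide)
    also have "\<dots> \<le> 1 * 2 powr (- \<alpha> * K)"
      using \<alpha> mult_right_mono[of \<alpha> 1 "real K"] by (simp del: mult_cancel_right1)
    also have "\<dots> \<le> r" unfolding r_def using C1 by (intro mult_right_mono) auto
    finally have rK: "(1/2) ^ K \<le> r" .
    have cr: "norm (f q - avg K q) \<le> r" for q using avg_close by (simp add: r_def)
    have "{q\<in>P \<inter> dcube K p. norm (f q - avg K p) \<le> r} = P \<inter> dcube K p"
    proof -
      have "norm (f q - avg K p) \<le> r" if "q \<in> dcube K p" for q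
        using cr[of q] avg_cong[OF that] by simp
      then show ?thesis by blast
    qed
    then have "S K p * D K \<le> 4 ^ CARD('m) * r ^ CARD('m)"
      using ball_mass[OF k0K _ rK, of p "avg K p"] by (simp add: S_def)
    then have "e * (S K p * D K) \<le> e * (4 ^ CARD('m) * r ^ CARD('m))" using e by (intro mult_left_mono) auto
    also have "\<dots> = (4 ^ CARD('m) * e) * r ^ CARD('m)" by simp
    also have "\<dots> \<le> 1 * r ^ CARD('m)" using e r0 by (intro mult_right_mono) auto
    finally have "v K p \<le> r ^ CARD('m)"
      unfolding v_def c_def using cr by (auto intro!: power_mono simp: mult.assoc)
    then have "ln (v K p) \<le> ln (r ^ CARD('m))" using v_pos[OF p, of K] k0K r0 by simp
    also have "\<dots> = CARD('m) * ln C1 - \<alpha> * K * CARD('m) * ln 2"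
      using C1 r0 by (simp add: ln_realpow) (simp add: r_def ln_mult ln_powr algebra_simps)
    finally show ?thesis using 1 by (simp add: B_def)
  qed
  have tele: "ln (v k0 p) - ln (v j p) \<le> (\<Sum>k=k0..<j. loss k p)" if p: "p \<in> U" and j: "k0 \<le> j" "j \<le> K" for p j
    using j
  proof (induction j rule: dec_induct)
    case (step j)
    then show ?case using v_step[OF p, of j] by (simp add: loss_def \<delta>_def)
  qed simp
  have loss_sum: "(\<Sum>p\<in>U. w p * loss k p) \<le> (\<alpha> * CARD('m) * ln 2 / 4) * h" if k: "k0 \<le> k" "k < K" for k
  proof -
    let ?g = "\<lambda>p. w p * sqrt (S k p / S (Suc k) p)"
    have good: "(\<Sum>p\<in>U. if p \<in> good k then ?g p else 0) = (\<Sum>p\<in>good k. ?g p)"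
    proof -
      have "U \<inter> good k = good k" by (auto simp: good_def)
      then show ?thesis using finU by (simp add: sum.inter_restrict[symmetric])
    qed
    have "(\<Sum>p\<in>U. w p * loss k p) = (\<Sum>p\<in>U. \<delta> * w p + 2 * (if p \<in> good k then ?g p else 0))"
      by (intro sum.cong) (auto simp: loss_def algebra_simps)
    also have "\<dots> = \<delta> * sum w U + 2 * (\<Sum>p\<in>good k. ?g p)"
      unfolding sum.distrib good[symmetric] sum_distrib_left ..
    also have "\<dots> \<le> \<delta> * h + 2 * (2 ^ CARD('n) * sqrt (4 ^ CARD('m) * e) * h)"
      unfolding h_def using k UP finP w_nonneg \<delta>0
      by (intro add_mono mult_left_mono sum_mono2 good_sum) auto
    also have "\<dots> = (\<delta> + 2 * (2 ^ CARD('n) * sqrt (4 ^ CARD('m) * e))) * h"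
      by (simp add: algebra_simps)
    also have "\<dots> \<le> (\<alpha> * CARD('m) * ln 2 / 4) * h"
      using small h0 by (intro mult_right_mono) (auto simp: \<delta>_def)
    finally show ?thesis .
  qed
  define X Y where "X = CARD('m) * (\<alpha> * K * ln 2)" and "Y = CARD('m) * (k0 * ln 2 + ln C1)"
  have "CARD('m) * (4 * (k0 * ln 2 + ln C1)) < X"
    unfolding X_def by (rule mult_strict_left_mono[OF large]) simp
  moreover have "CARD('m) * (4 * (k0 * ln 2 + ln C1)) = 4 * Y" by (simp add: Y_def)
  moreover have "0 \<le> Y" using C1' by (simp add: Y_def)
  moreover have "B = X - Y" by (simp add: B_def X_def Y_def algebra_simps)
  moreover have "\<alpha> * K * CARD('m) * ln 2 / 2 = X / 2" by (simp add: X_def)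
  ultimately have B': "\<alpha> * K * CARD('m) * ln 2 / 2 < B" by linarith
  have B0: "0 \<le> \<alpha> * K * CARD('m) * ln 2 / 2" using \<alpha> by simp
  have "B * (h / 2) \<le> B * sum w U" using hU B' B0 by (intro mult_left_mono) auto
  also have "\<dots> \<le> (\<Sum>p\<in>U. w p * (\<Sum>k=k0..<K. loss k p))"
  proof (subst sum_distrib_left, rule sum_mono)
    fix p assume "p \<in> U"
    then have "B \<le> (\<Sum>k=k0..<K. loss k p)" using low tele[OF _ k0K order.refl] by fastforce
    then show "B * w p \<le> w p * (\<Sum>k=k0..<K. loss k p)"
      using w_nonneg[of p] by (subst mult.commute) (rule mult_left_mono)
  qed
  also have "\<dots> = (\<Sum>k=k0..<K. \<Sum>p\<in>U. w p * loss k p)"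
    unfolding sum_distrib_left by (rule sum.swap)
  also have "\<dots> \<le> (\<Sum>k=k0..<K. (\<alpha> * CARD('m) * ln 2 / 4) * h)" by (intro sum_mono loss_sum) auto
  also have "\<dots> = (K - k0) * ((\<alpha> * CARD('m) * ln 2 / 4) * h)" using k0K by simp
  also have "\<dots> \<le> K * ((\<alpha> * CARD('m) * ln 2 / 4) * h)"
    using h0 \<alpha> by (intro mult_right_mono) auto
  also have "\<dots> = (\<alpha> * K * CARD('m) * ln 2 / 2) * (h / 2)" by simp
  also have "\<dots> < B * (h / 2)" using B' h0 by (intro mult_strict_right_mono) auto
  finally show False by simp
qed

end

section \<open>Covering the graph over a dyadic cube by cells\<close>

lemma dcube_component:
  assumes "y \<in> dcube k x"
  shows "\<bar>y $ i - x $ i\<bar> \<le> (1/2) ^ k"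
proof -
  have "\<lfloor>2 ^ k * y $ i\<rfloor> = \<lfloor>2 ^ k * x $ i\<rfloor>"
    using assms by (auto simp: dcube_def dkey_def fun_eq_iff)
  then have "\<bar>2 ^ k * y $ i - 2 ^ k * x $ i\<bar> \<le> 1"
    using floor_correct[of "2 ^ k * y $ i"] floor_correct[of "2 ^ k * x $ i"] by linarith
  then have "2 ^ k * \<bar>y $ i - x $ i\<bar> \<le> 1"
    by (simp add: right_diff_distrib[symmetric] abs_mult)
  then show ?thesis by (simp add: power_one_over field_simps)
qed

lemma dcube_dist:
  fixes x :: "real^'k::finite"
  assumes "y \<in> dcube k x"
  shows "dist y x \<le> CARD('k) * (1/2) ^ k"
proof -
  have "dist y x \<le> (\<Sum>i\<in>UNIV. \<bar>(y - x) $ i\<bar>)"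
    unfolding dist_norm by (rule norm_le_l1_cart)
  also have "\<dots> \<le> (\<Sum>i\<in>(UNIV::'k set). (1/2) ^ k)"
    using dcube_component[OF assms] by (intro sum_mono) auto
  finally show ?thesis by simp
qed

context dyadic_telescope
begin

text \<open>A dyadic cell of side 2^-k in the product space, pulled back to the domain by the graph
  mapping.\<close>

definition cell :: "nat \<Rightarrow> real^'n \<Rightarrow> (real^'n) set" where
  "cell k p = {x. dkey k x = dkey k p \<and> dkey k (f x) = dkey k (f p)}"

text \<open>The conclusion of \<open>total_mass\<close> freed from the auxiliary constants: every
  finite weight satisfying the Frostman condition between \<open>k0\<close> and \<open>K\<close> has
  controlled total mass.\<close>

definition controls :: "real \<Rightarrow> nat \<Rightarrow> nat \<Rightarrow> bool" where
  "controls \<Lambda> k0 K \<longleftrightarrow> (\<forall>P (w :: real^'n \<Rightarrow> real) x0.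
     finite P \<longrightarrow> (\<forall>p. 0 \<le> w p) \<longrightarrow> P \<subseteq> dcube k0 x0 \<longrightarrow>
     (\<forall>k\<in>{k0..K}. \<forall>p\<in>P. sum w (P \<inter> cell k p) \<le> (1/2) ^ (k * CARD('n))) \<longrightarrow>
     sum w P \<le> \<Lambda> * \<mu> (dcube k0 x0))"

lemma controls_exists: "\<exists>\<Lambda>>0. \<forall>k0. \<exists>K\<ge>k0. controls \<Lambda> k0 K"
proof -
  \<comment> \<open>Half of the loss per level that \<open>total_mass\<close> tolerates.
    \<open>\<gamma>\<close> is chosen to cost exactly this much, and \<open>e\<close> to make the
    good points cost at most half as much again.\<close>
  define \<delta> where "\<delta> = \<alpha> * CARD('m) * ln 2 / 8"
  have \<delta>: "0 < \<delta>" using \<alpha> by (simp add: \<delta>_def)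
  define \<gamma> where "\<gamma> = 1 - exp (- \<delta> / CARD('m))"
  have \<gamma>: "0 < \<gamma>" "\<gamma> < 1" and \<gamma>_ln: "CARD('m) * ln (1 - \<gamma>) = - \<delta>"
    using \<delta> by (auto simp: \<gamma>_def)
  \<comment> \<open>The minimum with 1 secures \<open>4 ^ CARD('m) * e \<le> 1\<close>; the other
    entry is the square of the bound wanted for sqrt(4^m e).\<close>
  define e where "e = min 1 ((\<delta> / (4 * 2 ^ CARD('n))) ^ 2) / 4 ^ CARD('m)"
  have e: "0 < e" "4 ^ CARD('m) * e \<le> 1"
    using \<delta> by (auto simp: e_def)
  have "sqrt (4 ^ CARD('m) * e) \<le> \<delta> / (4 * 2 ^ CARD('n))"
    using \<delta> by (intro real_le_lsqrt) (auto simp: e_def)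
  then have e': "2 * (2 ^ CARD('n) * sqrt (4 ^ CARD('m) * e)) \<le> \<delta> / 2"
    by (simp add: field_simps)
  define \<Lambda> where "\<Lambda> = max (1 / e) (C2 / (e * \<gamma> ^ CARD('m)))"
  have \<Lambda>: "1 / e \<le> \<Lambda>" "C2 / (e * \<gamma> ^ CARD('m)) \<le> \<Lambda>" by (auto simp: \<Lambda>_def)
  have \<Lambda>': "1 \<le> e * \<Lambda>" using \<Lambda>(1) e by (simp add: field_simps)
  have \<Lambda>'': "C2 \<le> e * \<Lambda> * \<gamma> ^ CARD('m)" using \<Lambda>(2) e \<gamma> by (simp add: field_simps)
  have \<Lambda>0: "0 < \<Lambda>" using \<Lambda>(1) e by (smt (verit) zero_less_divide_1_iff)
  show ?thesis
  proof (intro exI[of _ "2 * \<Lambda>"] conjI allI)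
    fix k0 :: nat
    have "\<alpha> * ln 2 > 0" using \<alpha> by simp
    then obtain N :: nat where "4 * (k0 * ln 2 + ln C1) < N * (\<alpha> * ln 2)"
      using reals_Archimedean3 by blast
    moreover have "N * (\<alpha> * ln 2) \<le> max N k0 * (\<alpha> * ln 2)" using \<alpha> by (intro mult_right_mono) auto
    ultimately have large: "4 * (k0 * ln 2 + ln C1) < \<alpha> * max N k0 * ln 2" by (simp add: mult_ac)
    have "controls (2 * \<Lambda>) k0 (max N k0)"
      unfolding controls_def
    proof (intro allI impI)
      fix P and w :: "real^'n \<Rightarrow> real" and x0
      assume P: "finite P" "\<forall>p. 0 \<le> w p" "P \<subseteq> dcube k0 x0"
        and cells: "\<forall>k\<in>{k0..max N k0}. \<forall>p\<in>P. sum w (P \<inter> cell k p) \<le> (1/2) ^ (k * CARD('n))"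
      have cell_Int: "P \<inter> cell k p = {q\<in>P. dkey k q = dkey k p \<and> dkey k (f q) = dkey k (f p)}" for k p
        by (auto simp: cell_def)
      interpret dyadic_mass f avg \<mu> \<alpha> C1 C2 P w k0 "max N k0" x0 \<gamma> e \<Lambda>
      proof unfold_locales
        fix k p assume "k0 \<le> k" "k \<le> max N k0" "p \<in> P"
        then show "sum w {q \<in> P. dkey k q = dkey k p \<and> dkey k (f q) = dkey k (f p)} \<le> (1/2) ^ (k * CARD('n))"
          unfolding cell_Int[symmetric] using cells by simp
      qed (fact P(1) P(3) \<gamma> e \<Lambda>' \<Lambda>'' | simp add: P(2))+
      show "sum w P \<le> 2 * \<Lambda> * \<mu> (dcube k0 x0)"
        using e' \<gamma>_ln \<delta> by (intro total_mass large) (simp add: \<delta>_def)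
    qed
    then show "\<exists>K\<ge>k0. controls (2 * \<Lambda>) k0 K" by (intro exI[of _ "max N k0"]) simp
  qed (use \<Lambda>0 in auto)
qed

lemma finite_keys:
  fixes A :: "(real^'k::finite) set"
  assumes "bounded A"
  shows "finite (dkey k ` A)"
proof -
  obtain x r where "A \<subseteq> cball x r" using assms bounded_subset_cball by blast
  then have "A \<subseteq> cball x (max r 1)" by auto
  moreover have "finite (dkey k ` cball x (max r 1))"
    using power_le_one[of "1/2::real" k] by (intro keys_meeting_cball(1)) auto
  ultimately show ?thesis by (meson finite_subset image_mono)
qed

lemma bounded_dcube: "bounded (dcube k (x :: real^'k::finite))"
proof (rule bounded_subset[OF bounded_cball])
  show "dcube k x \<subseteq> cball x (CARD('k) * (1/2) ^ k)"
    using dcube_dist[of _ k x] by (subst subset_iff) (simp add: dist_commute)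
qed

lemma bounded_f_dcube: "bounded (f ` dcube k x)"
proof -
  have "f ` dcube k x \<subseteq> cball (avg k x) (C1 * 2 powr (- \<alpha> * k))"
  proof (rule image_subsetI)
    fix y assume "y \<in> dcube k x"
    then show "f y \<in> cball (avg k x) (C1 * 2 powr (- \<alpha> * k))"
      using avg_close[of y k] avg_cong[of y k x] by (simp add: dist_norm norm_minus_commute)
  qed
  then show ?thesis by (rule bounded_subset[OF bounded_cball])
qed

text \<open>Around each point take the largest saturated cell of the greedy weight. These cells are
  disjoint and their capacities are masses, so the capacities add up to at most the total mass,
  which \<open>controls\<close> bounds. The constant must not depend on the cube.\<close>

lemma cell_cover:
  "\<exists>\<Lambda>>0. \<forall>k0 x0. \<exists>\<C> lev. finite \<C> \<and> dcube k0 x0 \<subseteq> \<Union>\<C> \<and>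
     (\<forall>C\<in>\<C>. k0 \<le> lev C \<and> (\<exists>p. C = cell (lev C) p)) \<and>
     (\<Sum>C\<in>\<C>. (1/2) ^ (lev C * CARD('n))) \<le> \<Lambda> * \<mu> (dcube k0 x0)"
proof -
  obtain \<Lambda> where \<Lambda>: "0 < \<Lambda>" and ctrl: "\<And>k0. \<exists>K\<ge>k0. controls \<Lambda> k0 K"
    using controls_exists by blast
  let ?key = "\<lambda>k x. (dkey k x, dkey k (f x))"
  interpret cells: nested_keys ?key
  proof
    fix k x y assume "?key (Suc k) x = ?key (Suc k) y"
    then have "dkey (Suc k) x = dkey (Suc k) y" "dkey (Suc k) (f x) = dkey (Suc k) (f y)" by auto
    from this[THEN dkey_Suc] show "?key k x = ?key k y" by simp
  qed
  have cells_stop: "cells.stop_cell R x = cell (cells.stop R x) x" for R x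
    by (simp add: cells.stop_cell_def cell_def)
  have "\<exists>\<C> lev. finite \<C> \<and> dcube k0 x0 \<subseteq> \<Union>\<C> \<and>
     (\<forall>C\<in>\<C>. k0 \<le> lev C \<and> (\<exists>p. C = cell (lev C) p)) \<and>
     (\<Sum>C\<in>\<C>. (1/2) ^ (lev C * CARD('n))) \<le> \<Lambda> * \<mu> (dcube k0 x0)" for k0 x0
  proof -
    obtain K where K: "k0 \<le> K" and ctrl: "controls \<Lambda> k0 K"
      using ctrl by blast
    let ?Q = "dcube k0 x0"
    have "?key K ` ?Q \<subseteq> dkey K ` ?Q \<times> dkey K ` f ` ?Q" by auto
    then have fin: "finite (?key K ` ?Q)"
      using finite_keys[OF bounded_dcube] finite_keys[OF bounded_f_dcube]
      by (meson finite_SigmaI finite_subset)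
    \<comment> \<open>One representative for each of the finitely many cells of the finest level
      that meet the cube. Covering their cells covers the whole cube, since coarser cells are unions
      of finest ones.\<close>
    then obtain P where P: "P \<subseteq> ?Q" "finite P" "?key K ` ?Q = ?key K ` P"
      using finite_subset_image[OF fin order.refl] by metis
    have rep: "\<exists>p\<in>P. ?key K p = ?key K x" if "x \<in> ?Q" for x
      using P(3) that by (metis (no_types, lifting) image_iff)
    have "\<exists>w :: real^'n \<Rightarrow> real. (\<forall>p. 0 \<le> w p) \<and>
        (\<forall>d\<in>{k0..K} \<times> P. sum w (P \<inter> (case d of (k, p) \<Rightarrow> cell k p)) \<le> (case d of (k, p) \<Rightarrow> (1/2) ^ (k * CARD('n)))) \<and>
        (\<forall>p\<in>P. \<exists>d\<in>{k0..K} \<times> P. p \<in> (case d of (k, p) \<Rightarrow> cell k p) \<and>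
           sum w (P \<inter> (case d of (k, p) \<Rightarrow> cell k p)) = (case d of (k, p) \<Rightarrow> (1/2) ^ (k * CARD('n))))"
    proof (rule saturating_weights)
      fix p assume "p \<in> P"
      then show "\<exists>d\<in>{k0..K} \<times> P. p \<in> (case d of (k, p) \<Rightarrow> cell k p)"
        using K by (intro bexI[of _ "(k0, p)"]) (auto simp: cell_def)
    qed (use P in auto)
    then obtain w :: "real^'n \<Rightarrow> real" where w0: "\<forall>p. 0 \<le> w p"
      and w: "\<forall>d\<in>{k0..K} \<times> P. sum w (P \<inter> (case d of (k, p) \<Rightarrow> cell k p)) \<le> (case d of (k, p) \<Rightarrow> (1/2) ^ (k * CARD('n)))"
        "\<forall>p\<in>P. \<exists>d\<in>{k0..K} \<times> P. p \<in> (case d of (k, p) \<Rightarrow> cell k p) \<and>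
           sum w (P \<inter> (case d of (k, p) \<Rightarrow> cell k p)) = (case d of (k, p) \<Rightarrow> (1/2) ^ (k * CARD('n)))"
      by (elim exE conjE)
    have w1: "\<forall>k\<in>{k0..K}. \<forall>p\<in>P. sum w (P \<inter> cell k p) \<le> (1/2) ^ (k * CARD('n))"
      using w(1) by auto
    have w2: "\<exists>k\<in>{k0..K}. \<exists>q\<in>P. p \<in> cell k q \<and> sum w (P \<inter> cell k q) = (1/2) ^ (k * CARD('n))"
      if "p \<in> P" for p
      using bspec[OF w(2) that] by auto
    have bound: "sum w P \<le> \<Lambda> * \<mu> ?Q" 
      by (rule ctrl[unfolded controls_def, rule_format, OF P(2) _ P(1)]) (use w0 w1 in auto)
    define R where "R k x \<longleftrightarrow> k0 \<le> k \<and> k \<le> K \<and> sum w (P \<inter> cell k x) = (1/2) ^ (k * CARD('n))" for k x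
    have cell_eq: "cell k x = cell k y" if "?key k x = ?key k y" for k x y
      using that by (auto simp: cell_def)
    have R_cong: "R k y" if "?key k x = ?key k y" "R k x" for k x y
      using cell_eq[OF that(1)] that(2) by (simp add: R_def)
    have ex: "\<exists>k. R k x" if x: "x \<in> ?Q" for x
    proof -
      obtain p where p: "p \<in> P" "?key K p = ?key K x" using rep[OF x] by blast
      obtain k q where k: "k \<in> {k0..K}" "p \<in> cell k q" "sum w (P \<inter> cell k q) = (1/2) ^ (k * CARD('n))"
        using w2[OF p(1)] by blast
      have "?key k x = ?key k p" using cells.nested[of k K p x] p(2) k(1) by simp
      moreover have "?key k p = ?key k q" using k(2) by (simp add: cell_def)
      ultimately have "cell k x = cell k q" by (intro cell_eq) simp
      then show ?thesis using k by (auto simp: R_def)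
    qed
    have R_stop: "R (cells.stop R x) x" if "x \<in> ?Q" for x
      using ex[OF that] unfolding cells.stop_def by (rule LeastI_ex)
    define \<C> where "\<C> = cells.stop_cell R ` P"
    \<comment> \<open>The level is read off from the set itself, as distinct points may yield the
      same cell. By \<open>stop_eq\<close> the chosen element does not influence the result.\<close>
    define lev where "lev C = cells.stop R (SOME x. x \<in> C)" for C
    have lev: "lev (cells.stop_cell R x) = cells.stop R x" if "x \<in> ?Q" for x
    proof -
      have "(SOME y. y \<in> cells.stop_cell R x) \<in> cells.stop_cell R x"
        by (rule someI[of _ x]) (rule cells.self_mem_stop_cell)
      then show ?thesis
        unfolding lev_def using R_cong R_stop[OF that] by (intro cells.stop_eq[where R = R]) blast+
    qed
    have finC: "finite \<C>" using P by (simp add: \<C>_def)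
    have "disjoint (cells.stop_cell R ` {x. \<exists>k. R k x})"
      using R_cong by (intro cells.disjoint_stop_cells) blast
    moreover have "\<C> \<subseteq> cells.stop_cell R ` {x. \<exists>k. R k x}" using ex P by (auto simp: \<C>_def)
    ultimately have disj: "disjoint \<C>" by (rule pairwise_subset)
    have cov: "?Q \<subseteq> \<Union>\<C>"
    proof
      fix x assume x: "x \<in> ?Q"
      obtain p where p: "p \<in> P" "?key K p = ?key K x" using rep[OF x] by blast
      have "?key (cells.stop R p) x = ?key (cells.stop R p) p"
        using cells.nested[of "cells.stop R p" K p x] p R_stop[of p] P by (auto simp: R_def)
      then have "x \<in> cells.stop_cell R p" by (simp add: cells.stop_cell_def)
      then show "x \<in> \<Union>\<C>" using p by (auto simp: \<C>_def)
    qed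
    have C: "k0 \<le> lev C \<and> (\<exists>p. C = cell (lev C) p) \<and> sum w (P \<inter> C) = (1/2) ^ (lev C * CARD('n))"
      if C: "C \<in> \<C>" for C
    proof -
      obtain p where p: "p \<in> ?Q" "C = cells.stop_cell R p" using C P by (auto simp: \<C>_def)
      then show ?thesis using R_stop[of p] lev[of p] by (auto simp: R_def cells_stop)
    qed
    have "(\<Sum>C\<in>\<C>. (1/2) ^ (lev C * CARD('n))) = (\<Sum>C\<in>\<C>. sum w (P \<inter> C))"
      using C by (intro sum.cong) auto
    also have "\<dots> = sum w (\<Union>C\<in>\<C>. P \<inter> C)"
    proof (rule sum.UNION_disjoint[symmetric])
      show "\<forall>A\<in>\<C>. \<forall>B\<in>\<C>. A \<noteq> B \<longrightarrow> P \<inter> A \<inter> (P \<inter> B) = {}"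
        using disjointD[OF disj] by blast
    qed (use finC P in auto)
    also have "\<dots> \<le> sum w P" using P w0 by (intro sum_mono2) auto
    also have "\<dots> \<le> \<Lambda> * \<mu> ?Q" by (rule bound)
    finally show ?thesis using finC cov C by blast
  qed
  then show ?thesis using \<Lambda> by blast
qed

end

subsection \<open>Hausdorff measure\<close>

text \<open>Passes from the sequences in the definition to covers with an arbitrary countable index
  set, finite ones included, by padding with empty sets.\<close>

lemma hausdorff_pre_countable_cover:
  fixes B :: "'i \<Rightarrow> 'a::metric_space set"
  assumes I: "countable I" and cov: "A \<subseteq> (\<Union>i\<in>I. B i)" and s: "0 < s" and \<delta>: "0 \<le> \<delta>"
    and B: "\<And>i. i \<in> I \<Longrightarrow> bounded (B i) \<and> diameter (B i) \<le> \<delta>"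
  shows "hausdorff_pre s \<delta> A \<le> (\<integral>\<^sup>+i. ennreal (unit_ball_vol (real s) * (diameter (B i) / 2) ^ s) \<partial>count_space I)"
proof -
  let ?cost = "\<lambda>X::'a set. ennreal (unit_ball_vol (real s) * (diameter X / 2) ^ s)"
  let ?J = "to_nat_on I ` I"
  have bij: "bij_betw (to_nat_on I) I ?J"
    using inj_on_to_nat_on[OF I] by (simp add: bij_betw_def)
  define E where "E n = (if n \<in> ?J then B (from_nat_into I n) else {})" for n
  have E: "E (to_nat_on I i) = B i" if "i \<in> I" for i
    using that I by (simp add: E_def from_nat_into_to_nat_on)
  have "A \<subseteq> (\<Union>n. E n)"
  proof
    fix x assume "x \<in> A"
    then obtain i where "i \<in> I" "x \<in> B i" using cov by auto
    then have "x \<in> E (to_nat_on I i)" by (simp add: E)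
    then show "x \<in> (\<Union>n. E n)" by blast
  qed
  moreover have "bounded (E n) \<and> diameter (E n) \<le> \<delta>" for n
    using B I \<delta> by (auto simp: E_def from_nat_into_to_nat_on)
  ultimately have "hausdorff_pre s \<delta> A \<le> (\<Sum>n. ?cost (E n))"
    unfolding hausdorff_pre_def by (intro INF_lower) auto
  also have "\<dots> = (\<integral>\<^sup>+n. ?cost (E n) \<partial>count_space UNIV)"
    by (simp add: nn_integral_count_space_nat)
  \<comment> \<open>The padding is free because \<open>0 < s\<close> makes the power of the zero
    diameter vanish.\<close>
  also have "\<dots> = (\<integral>\<^sup>+n. ?cost (E n) * indicator ?J n \<partial>count_space UNIV)"
    using s by (intro nn_integral_cong) (auto simp: E_def indicator_def)
  also have "\<dots> = (\<integral>\<^sup>+n. ?cost (E n) \<partial>count_space ?J)"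
    by (rule nn_integral_count_space_indicator[symmetric]) simp
  also have "\<dots> = (\<integral>\<^sup>+i. ?cost (E (to_nat_on I i)) \<partial>count_space I)"
    by (rule nn_integral_bij_count_space[OF bij, symmetric])
  also have "\<dots> = (\<integral>\<^sup>+i. ?cost (B i) \<partial>count_space I)"
    by (intro nn_integral_cong) (simp add: E)
  finally show ?thesis .
qed

text \<open>The defining description has exactly one solution: existence is the orthogonal
  decomposition, and the difference of two solutions lies in \<open>V\<close> and is orthogonal to
  itself. Pythagoras then gives the Lipschitz bound.\<close>

lemma orth_proj_dist_le:
  fixes V :: "'a::euclidean_space set"
  assumes "subspace V"
  shows "dist (orth_proj V x) (orth_proj V y) \<le> dist x y"
proof -
  have proj: "orth_proj V x \<in> V \<and> (\<forall>w\<in>V. (x - orth_proj V x) \<bullet> w = 0)" for x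
  proof -
    obtain u z where u: "u \<in> span V" "\<And>w. w \<in> span V \<Longrightarrow> orthogonal z w" "x = u + z"
      using orthogonal_subspace_decomp_exists[of V x] by metis
    have uV: "u \<in> V \<and> (\<forall>w\<in>V. (x - u) \<bullet> w = 0)"
      using u span_eq_iff[THEN iffD2, OF assms] by (simp add: orthogonal_def)
    have "v = u" if v: "v \<in> V \<and> (\<forall>w\<in>V. (x - v) \<bullet> w = 0)" for v
    proof -
      have "v - u \<in> V" using uV v assms by (simp add: subspace_diff)
      then have "(x - u) \<bullet> (v - u) = 0" "(x - v) \<bullet> (v - u) = 0"
        using uV v by blast+
      then have "((x - u) - (x - v)) \<bullet> (v - u) = 0" by (subst inner_diff_left) simp
      then show ?thesis by simp
    qed
    then have "orth_proj V x = u"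
      unfolding orth_proj_def using uV by (intro the_equality)
    then show ?thesis using uV by simp
  qed
  define a where "a = orth_proj V x - orth_proj V y"
  define b where "b = (x - y) - a"
  have "a \<in> V" using proj assms by (simp add: a_def subspace_diff)
  then have "(x - orth_proj V x) \<bullet> a = 0" "(y - orth_proj V y) \<bullet> a = 0"
    using proj by blast+
  moreover have "b = (x - orth_proj V x) - (y - orth_proj V y)" by (simp add: b_def a_def)
  ultimately have "orthogonal a b"
    by (simp add: orthogonal_def inner_commute[of a] inner_diff_left)
  then have "norm (a + b) ^ 2 = norm a ^ 2 + norm b ^ 2" by (rule norm_add_Pythagorean)
  then have "norm a ^ 2 \<le> norm (x - y) ^ 2" by (simp add: b_def)
  then have "norm a \<le> norm (x - y)" by (rule power2_le_imp_le) simp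
  then show ?thesis by (simp add: a_def dist_norm)
qed

section \<open>Dyadic decomposition of open sets\<close>

lemma dcube_borel [measurable]: "dcube k (x :: real^'k::finite) \<in> sets borel"
proof -
  have "dcube k x = (\<Inter>i. {y. real_of_int (dkey k x i) \<le> 2 ^ k * y $ i} \<inter> {y. 2 ^ k * y $ i < real_of_int (dkey k x i) + 1})"
    by (auto simp: dcube_def dkey_def fun_eq_iff floor_eq_iff)
  also have "\<dots> \<in> sets borel"
    by (intro sets.finite_INT sets.Int borel_closed borel_open closed_Collect_le open_Collect_less
        continuous_intros) auto
  finally show ?thesis .
qed

lemma countable_dcubes: "countable (range (case_prod (dcube :: nat \<Rightarrow> real^'k::finite \<Rightarrow> _)))"
proof -
  have "range (case_prod dcube) \<subseteq> (\<lambda>(k, z). {y :: real^'k. dkey k y = z}) ` UNIV"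
  proof clarsimp
    fix k and x :: "real^'k"
    show "dcube k x \<in> range (\<lambda>(k, z). {y :: real^'k. dkey k y = z})"
      by (rule range_eqI[of _ _ "(k, dkey k x)"]) (simp add: dcube_def)
  qed
  then show ?thesis by (rule countable_subset) (intro countable_image countableI_type)
qed

text \<open>Take the maximal dyadic cubes of level at least \<open>k0\<close> inside
  \<open>G\<close>. Every point has one, because dyadic cubes shrink to the point and
  \<open>G\<close> is open.\<close>

lemma open_dcube_partition:
  fixes G :: "(real^'k::finite) set"
  assumes "open G"
  shows "\<exists>\<Q>. countable \<Q> \<and> disjoint \<Q> \<and> \<Union>\<Q> = G \<and> (\<forall>Q\<in>\<Q>. \<exists>k\<ge>k0. \<exists>x. Q = dcube k x)"
proof -
  define R where "R k x \<longleftrightarrow> k0 \<le> k \<and> dcube k x \<subseteq> G" for k and x :: "real^'k"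
  have R_cong: "R k y" if "dkey k x = dkey k y" "R k x" for k x y
    using that by (simp add: R_def dcube_def)
  have ex: "\<exists>k. R k x" if x: "x \<in> G" for x
  proof -
    obtain r where r: "0 < r" "ball x r \<subseteq> G" using assms x openE by blast
    obtain j where j: "(1/2) ^ j < r / CARD('k)" using real_arch_pow_inv[of "r / CARD('k)" "1/2"] r by auto
    define k where "k = max j k0"
    have "(1/2::real) ^ k \<le> (1/2) ^ j" by (intro power_decreasing) (auto simp: k_def)
    then have "(1/2) ^ k < r / CARD('k)" using j by linarith
    then have "CARD('k) * (1/2) ^ k < r" by (simp add: field_simps)
    then have "dcube k x \<subseteq> ball x r"
      using dcube_dist[of _ k x] by (fastforce simp: dist_commute)
    then have "R k x" using r by (auto simp: R_def k_def)
    then show ?thesis ..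
  qed
  have R_stop: "R (dyadic.stop R x) x" if "x \<in> G" for x
    using ex[OF that] unfolding dyadic.stop_def by (rule LeastI_ex)
  define \<Q> where "\<Q> = dyadic.stop_cell R ` G"
  have "\<Q> \<subseteq> range (case_prod dcube)"
    by (auto simp: \<Q>_def dyadic_stop_cell intro!: image_eqI[where x="(_, _)"])
  then have "countable \<Q>" using countable_dcubes by (rule countable_subset)
  moreover have "disjoint \<Q>"
  proof -
    have "disjoint (dyadic.stop_cell R ` {x. \<exists>k. R k x})"
      using R_cong by (intro dyadic.disjoint_stop_cells) blast
    moreover have "\<Q> \<subseteq> dyadic.stop_cell R ` {x. \<exists>k. R k x}" using ex by (auto simp: \<Q>_def)
    ultimately show ?thesis by (rule pairwise_subset)
  qed
  moreover have "\<Union>\<Q> = G"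
    using R_stop by (force simp: \<Q>_def dyadic_stop_cell R_def)
  moreover have "\<forall>Q\<in>\<Q>. \<exists>k\<ge>k0. \<exists>x. Q = dcube k x"
    using R_stop by (force simp: \<Q>_def dyadic_stop_cell R_def)
  ultimately show ?thesis by blast
qed

section \<open>From cell covers to vanishing Hausdorff measure\<close>

context dyadic_telescope
begin

lemma cell_dist:
  assumes "x \<in> cell k p" "y \<in> cell k p"
  shows "dist x y + dist (f x) (f y) \<le> (CARD('n) + CARD('m)) * (1/2) ^ k"
proof -
  have "x \<in> dcube k y" "f x \<in> dcube k (f y)" using assms by (auto simp: cell_def dcube_def)
  from this[THEN dcube_dist] show ?thesis by (simp add: algebra_simps)
qed

text \<open>On a cell of level k the map \<open>g\<close> oscillates by at most a constant times
  2^-k, so the cover of each cube costs a constant times its \<open>\<mu>\<close>. Over the disjoint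
  cubes of a small open set the costs add up to a multiple of its measure. Stating this for
  \<open>g\<close> covers projection and graph mapping at once.\<close>

lemma hausdorff_null:
  fixes g :: "real^'n \<Rightarrow> 'b::metric_space"
  assumes M: "sets M = sets lebesgue"
    and \<mu>: "\<And>k x. emeasure M (dcube k x) = ennreal (\<mu> (dcube k x))"
    and g: "\<And>x y. dist (g x) (g y) \<le> dist x y + dist (f x) (f y)"
    and N: "\<And>\<epsilon>. 0 < \<epsilon> \<Longrightarrow> \<exists>G. open G \<and> N \<subseteq> G \<and> emeasure M G \<le> ennreal \<epsilon>"
  shows "hausdorff_measure CARD('n) (g ` N) = 0"
proof -
  obtain \<Lambda> where \<Lambda>: "0 < \<Lambda>" and cover: "\<And>k0 x0. \<exists>\<C> lev. finite \<C> \<and> dcube k0 x0 \<subseteq> \<Union>\<C> \<and>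
     (\<forall>C\<in>\<C>. k0 \<le> lev C \<and> (\<exists>p. C = cell (lev C) p)) \<and>
     (\<Sum>C\<in>\<C>. (1/2) ^ (lev C * CARD('n))) \<le> \<Lambda> * \<mu> (dcube k0 x0)"
    using cell_cover by blast
  let ?d = "real (CARD('n) + CARD('m))"
  let ?cost = "\<lambda>X::'b set. unit_ball_vol (real CARD('n)) * (diameter X / 2) ^ CARD('n)"
  \<comment> \<open>The Hausdorff cost of a set of diameter \<open>?d\<close> times 2^-k is this
    number times 2^(-kn).\<close>
  define A where "A = unit_ball_vol (real CARD('n)) * (?d / 2) ^ CARD('n)"
  have "0 < CARD('n) + CARD('m)" by simp
  then have d0: "0 < ?d" by (simp only: of_nat_0_less_iff)
  then have "0 < ?d / 2" by (rule half_gt_zero)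
  then have A0: "0 < A" unfolding A_def by (intro mult_pos_pos unit_ball_vol_pos zero_less_power) auto
  have pre: "hausdorff_pre CARD('n) \<delta> (g ` N) \<le> ennreal (A * \<Lambda> * \<epsilon>)" if \<delta>: "0 < \<delta>" and \<epsilon>: "0 < \<epsilon>" for \<delta> \<epsilon>
  proof -
    have "0 < \<delta> / ?d" using \<delta> d0 by (rule divide_pos_pos)
    then have "\<exists>k0. (1/2) ^ k0 < \<delta> / ?d" by (rule real_arch_pow_inv) simp
    then obtain k0 where k0: "(1/2) ^ k0 < \<delta> / ?d" ..
    obtain G where G: "open G" "N \<subseteq> G" "emeasure M G \<le> ennreal \<epsilon>" using N[OF \<epsilon>] by blast
    obtain \<Q> where \<Q>: "countable \<Q>" "disjoint \<Q>" "\<Union>\<Q> = G" "\<And>Q. Q \<in> \<Q> \<Longrightarrow> \<exists>k\<ge>k0. \<exists>x. Q = dcube k x"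
      using open_dcube_partition[OF G(1), of k0] by blast
    have "\<forall>Q\<in>\<Q>. \<exists>\<C> lev. finite \<C> \<and> Q \<subseteq> \<Union>\<C> \<and> (\<forall>C\<in>\<C>. k0 \<le> lev C \<and> (\<exists>p. C = cell (lev C) p)) \<and>
       (\<Sum>C\<in>\<C>. (1/2) ^ (lev C * CARD('n))) \<le> \<Lambda> * \<mu> Q"
    proof
      fix Q assume "Q \<in> \<Q>"
      then obtain k x where "k0 \<le> k" "Q = dcube k x" using \<Q>(4) by blast
      then show "\<exists>\<C> lev. finite \<C> \<and> Q \<subseteq> \<Union>\<C> \<and> (\<forall>C\<in>\<C>. k0 \<le> lev C \<and> (\<exists>p. C = cell (lev C) p)) \<and>
       (\<Sum>C\<in>\<C>. (1/2) ^ (lev C * CARD('n))) \<le> \<Lambda> * \<mu> Q"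
        using cover[of k x] by (meson order.trans)
    qed
    then obtain \<C> lev where C: "\<And>Q. Q \<in> \<Q> \<Longrightarrow> finite (\<C> Q)" "\<And>Q. Q \<in> \<Q> \<Longrightarrow> Q \<subseteq> \<Union>(\<C> Q)"
      "\<And>Q C. Q \<in> \<Q> \<Longrightarrow> C \<in> \<C> Q \<Longrightarrow> k0 \<le> lev Q C \<and> (\<exists>p. C = cell (lev Q C) p)"
      "\<And>Q. Q \<in> \<Q> \<Longrightarrow> (\<Sum>C\<in>\<C> Q. (1/2) ^ (lev Q C * CARD('n))) \<le> \<Lambda> * \<mu> Q"
      by metis
    have diam: "bounded (g ` C) \<and> diameter (g ` C) \<le> ?d * (1/2) ^ lev Q C"
      if QC: "Q \<in> \<Q>" "C \<in> \<C> Q" for Q C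
    proof -
      obtain p where p: "C = cell (lev Q C) p" using C(3)[OF QC] by blast
      have d: "dist u v \<le> ?d * (1/2) ^ lev Q C" if "u \<in> g ` C" "v \<in> g ` C" for u v
      proof -
        obtain x y where xy: "x \<in> C" "y \<in> C" "u = g x" "v = g y" using \<open>u \<in> g ` C\<close> \<open>v \<in> g ` C\<close> by blast
        then have "x \<in> cell (lev Q C) p" "y \<in> cell (lev Q C) p" using p by auto
        from cell_dist[OF this] g[of x y] xy show ?thesis by simp
      qed
      have "bounded (g ` C)" using d by (auto simp: bounded_two_points)
      moreover have "diameter (g ` C) \<le> ?d * (1/2) ^ lev Q C"
      proof (cases "C = {}")
        case True
        then show ?thesis by (simp add: diameter_def)
      next
        case False
        have "(SUP (u, v)\<in>g ` C \<times> g ` C. dist u v) \<le> ?d * (1/2) ^ lev Q C"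
        proof (rule cSUP_least)
          show "g ` C \<times> g ` C \<noteq> {}" using False by simp
        qed (use d in fast)
        then show ?thesis using False by (simp add: diameter_def)
      qed
      ultimately show ?thesis ..
    qed
    \<comment> \<open>Pairs index the cover, since one cell may be used over several cubes. The
      double sum is handled as an iterated integral over counting measures because there may be
      infinitely many cubes.\<close>
    let ?I = "Sigma \<Q> \<C>"
    have "hausdorff_pre CARD('n) \<delta> (g ` N) \<le> (\<integral>\<^sup>+i. ennreal (?cost (case i of (Q, C) \<Rightarrow> g ` C)) \<partial>count_space ?I)"
    proof (rule hausdorff_pre_countable_cover)
      show "countable ?I" using \<Q>(1) C(1)[THEN countable_finite] by (rule countable_SIGMA)
      show "g ` N \<subseteq> (\<Union>i\<in>?I. case i of (Q, C) \<Rightarrow> g ` C)"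
      proof (rule image_subsetI)
        fix x assume "x \<in> N"
        then obtain Q where Q: "Q \<in> \<Q>" "x \<in> Q" using G(2) \<Q>(3) by blast
        then obtain C where "C \<in> \<C> Q" "x \<in> C" using C(2) by blast
        then show "g x \<in> (\<Union>i\<in>?I. case i of (Q, C) \<Rightarrow> g ` C)"
          using Q by (intro UN_I[of "(Q, C)"]) auto
      qed
      fix i assume "i \<in> ?I"
      then obtain Q C where QC: "i = (Q, C)" "Q \<in> \<Q>" "C \<in> \<C> Q" by blast
      have "?d * (1/2) ^ lev Q C \<le> ?d * (1/2) ^ k0"
        using C(3)[OF QC(2,3)] by (intro mult_left_mono power_decreasing) auto
      also have "\<dots> \<le> ?d * (\<delta> / ?d)" using k0 d0 by (intro mult_left_mono) auto
      also have "\<dots> = \<delta>" using d0 by (simp only: nonzero_mult_div_cancel_left times_divide_eq_right less_irrefl)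
      finally show "bounded (case i of (Q, C) \<Rightarrow> g ` C) \<and> diameter (case i of (Q, C) \<Rightarrow> g ` C) \<le> \<delta>"
        using diam[OF QC(2,3)] QC(1) by auto
    qed (use \<delta> in auto)
    also have "\<dots> = (\<integral>\<^sup>+i. (case i of (Q, C) \<Rightarrow> ennreal (?cost (g ` C)) * indicator ?I (Q, C)) \<partial>count_space UNIV)"
      by (subst nn_integral_count_space_indicator) (auto intro!: nn_integral_cong split: prod.split)
    also have "\<dots> = (\<integral>\<^sup>+Q. \<integral>\<^sup>+C. ennreal (?cost (g ` C)) * indicator ?I (Q, C) \<partial>count_space UNIV \<partial>count_space UNIV)"
      by (subst nn_integral_fst_count_space[symmetric]) simp
    also have "\<dots> \<le> (\<integral>\<^sup>+Q. (ennreal (A * \<Lambda>) * emeasure M Q) * indicator \<Q> Q \<partial>count_space UNIV)"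
    proof (rule nn_integral_mono)
      fix Q
      show "(\<integral>\<^sup>+C. ennreal (?cost (g ` C)) * indicator ?I (Q, C) \<partial>count_space UNIV)
          \<le> (ennreal (A * \<Lambda>) * emeasure M Q) * indicator \<Q> Q"
      proof (cases "Q \<in> \<Q>")
        case True
        obtain k x where kx: "Q = dcube k x" using \<Q>(4)[OF True] by blast
        have "(\<integral>\<^sup>+C. ennreal (?cost (g ` C)) * indicator ?I (Q, C) \<partial>count_space UNIV)
            = (\<integral>\<^sup>+C. ennreal (?cost (g ` C)) * indicator (\<C> Q) C \<partial>count_space UNIV)"
          using True by (intro nn_integral_cong) (auto simp: indicator_def)
        also have "\<dots> = (\<integral>\<^sup>+C. ennreal (?cost (g ` C)) \<partial>count_space (\<C> Q))"
          by (rule nn_integral_count_space_indicator[symmetric]) simp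
        also have "\<dots> = (\<Sum>C\<in>\<C> Q. ennreal (?cost (g ` C)))"
          by (rule nn_integral_count_space_finite[OF C(1)[OF True]])
        also have "\<dots> \<le> (\<Sum>C\<in>\<C> Q. ennreal (A * (1/2) ^ (lev Q C * CARD('n))))"
        proof (intro sum_mono ennreal_leI)
          fix C assume "C \<in> \<C> Q"
          from diam[OF True this] have "bounded (g ` C)" "diameter (g ` C) / 2 \<le> (?d / 2) * (1/2) ^ lev Q C" by auto
          then have "?cost (g ` C) \<le> unit_ball_vol (real CARD('n)) * ((?d / 2) * (1/2) ^ lev Q C) ^ CARD('n)"
            using diameter_ge_0 unit_ball_vol_nonneg by (intro mult_left_mono power_mono) auto
          then show "?cost (g ` C) \<le> A * (1/2) ^ (lev Q C * CARD('n))"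
            by (simp only: A_def power_mult_distrib power_mult mult.assoc)
        qed
        also have "\<dots> = ennreal (A * (\<Sum>C\<in>\<C> Q. (1/2) ^ (lev Q C * CARD('n))))"
          using A0 by (subst sum_ennreal) (auto simp: sum_distrib_left)
        also have "\<dots> \<le> ennreal (A * (\<Lambda> * \<mu> Q))"
          using C(4)[OF True] A0 by (intro ennreal_leI mult_left_mono) auto
        also have "\<dots> = ennreal (A * \<Lambda>) * emeasure M Q"
          using A0 \<Lambda> \<mu>[of k x] kx by (simp add: ennreal_mult' mult.assoc[symmetric])
        finally show ?thesis using True by simp
      next
        case False
        then have "(\<integral>\<^sup>+C. ennreal (?cost (g ` C)) * indicator ?I (Q, C) \<partial>count_space UNIV)
            = (\<integral>\<^sup>+C. 0 \<partial>count_space (UNIV :: (real^'n) set set))"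
          by (intro nn_integral_cong) auto
        then show ?thesis by simp
      qed
    qed
    also have "\<dots> = (\<integral>\<^sup>+Q. ennreal (A * \<Lambda>) * emeasure M Q \<partial>count_space \<Q>)"
      by (rule nn_integral_count_space_indicator[symmetric]) simp
    also have "\<dots> = ennreal (A * \<Lambda>) * (\<integral>\<^sup>+Q. emeasure M Q \<partial>count_space \<Q>)"
      by (rule nn_integral_cmult) simp
    also have "(\<integral>\<^sup>+Q. emeasure M Q \<partial>count_space \<Q>) = emeasure M (\<Union>Q\<in>\<Q>. Q)"
    proof (rule emeasure_UN_countable[symmetric])
      show "disjoint_family_on (\<lambda>Q. Q) \<Q>"
        using \<Q>(2) by (auto simp: disjoint_family_on_def disjoint_def)
      show "Q \<in> sets M" if "Q \<in> \<Q>" for Q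
        using \<Q>(4)[OF that] M dcube_borel by (metis sets_completionI_sets sets_lborel)
    qed (rule \<Q>(1))
    also have "\<dots> \<le> ennreal \<epsilon>" using G(3) \<Q>(3) by simp
    also have "ennreal (A * \<Lambda>) * ennreal \<epsilon> = ennreal (A * \<Lambda> * \<epsilon>)"
      using A0 \<Lambda> by (simp add: ennreal_mult')
    finally show ?thesis by (simp add: mult_left_mono)
  qed
  have "hausdorff_pre CARD('n) \<delta> (g ` N) = 0" if \<delta>: "0 < \<delta>" for \<delta>
  proof -
    have small: "hausdorff_pre CARD('n) \<delta> (g ` N) \<le> ennreal \<epsilon>" if "0 < \<epsilon>" for \<epsilon>
      using pre[OF \<delta>, of "\<epsilon> / (A * \<Lambda>)"] that A0 \<Lambda> by simp
    have "hausdorff_pre CARD('n) \<delta> (g ` N) \<le> 0"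
    proof (rule ennreal_le_epsilon)
      fix \<epsilon> :: real assume "0 < \<epsilon>"
      from small[OF this] show "hausdorff_pre CARD('n) \<delta> (g ` N) \<le> 0 + ennreal \<epsilon>"
        by (simp only: add_0)
    qed
    then show ?thesis by simp
  qed
  then show ?thesis unfolding hausdorff_measure_def by (intro SUP_eq_const) auto
qed

end

subsection \<open>Smooth bumps\<close>

text \<open>The classical flat function exp(-1/t) with polynomial factors in 1/t, a family that is
  closed under differentiation.\<close>

definition flat :: "real poly \<Rightarrow> real \<Rightarrow> real" where
  "flat p t = (if 0 < t then poly p (inverse t) * exp (- inverse t) else 0)"

lemma poly_times_exp_tendsto_0: "((\<lambda>u. poly p u * exp (- u)) \<longlongrightarrow> 0) (at_top :: real filter)"
proof -
  have "((\<lambda>u. \<Sum>i\<le>degree p. coeff p i * (u ^ i / exp u)) \<longlongrightarrow> (\<Sum>i\<le>degree p. coeff p i * 0)) at_top"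
    by (intro tendsto_intros tendsto_power_div_exp_0)
  then show ?thesis
    by (simp add: poly_altdef sum_distrib_right exp_minus divide_inverse mult.assoc)
qed

lemma flat_tendsto_0: "(flat p \<longlongrightarrow> 0) (at 0)"
proof -
  have "((\<lambda>t. poly p (inverse t) * exp (- inverse t)) \<longlongrightarrow> 0) (at_right 0)"
    by (rule filterlim_compose[OF poly_times_exp_tendsto_0 filterlim_inverse_at_top_right])
  moreover have "\<forall>\<^sub>F t in at_right 0. poly p (inverse t) * exp (- inverse t) = flat p t"
    by (rule eventually_at_rightI[of 0 1]) (auto simp: flat_def)
  ultimately have "(flat p \<longlongrightarrow> 0) (at_right 0)"
    by (rule Lim_transform_eventually)
  moreover have "(flat p \<longlongrightarrow> 0) (at_left 0)"
    by (rule tendsto_eventually, rule eventually_at_leftI[of "-1"]) (auto simp: flat_def)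
  ultimately show ?thesis by (simp add: filterlim_at_split)
qed

text \<open>With u = 1/t and du/dt = -u^2, the derivative of p(u) exp(-u) is u^2 (p(u) - p'(u))
  exp(-u).\<close>

definition flat_deriv :: "real poly \<Rightarrow> real poly" where
  "flat_deriv p = [:0, 0, 1:] * (p - pderiv p)"

lemma flat_has_derivative: "(flat p has_real_derivative flat (flat_deriv p) t) (at t)"
proof -
  consider "0 < t" | "t < 0" | "t = 0" by linarith
  then show ?thesis
  proof cases
    case 1
    have "((\<lambda>t. poly p (inverse t) * exp (- inverse t)) has_real_derivative flat (flat_deriv p) t) (at t)"
      using 1 by (auto intro!: derivative_eq_intros DERIV_chain'[OF _ poly_DERIV]
          simp: flat_def flat_deriv_def power2_eq_square field_simps)
    then show ?thesis
      by (rule has_field_derivative_transform_within_open[of _ _ _ "{0<..}"]) (use 1 in \<open>auto simp: flat_def\<close>)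
  next
    case 2
    have "((\<lambda>_. 0) has_real_derivative 0) (at t)" by simp
    then have "(flat p has_real_derivative 0) (at t)"
      by (rule has_field_derivative_transform_within_open[of _ _ _ "{..<0}"]) (use 2 in \<open>auto simp: flat_def\<close>)
    then show ?thesis using 2 by (simp add: flat_def)
  next
    case 3
    \<comment> \<open>The difference quotient at 0 is again a flat function: dividing by h
      multiplies the polynomial by its variable.\<close>
    have "((\<lambda>h. (flat p h - flat p 0) / (h - 0)) \<longlongrightarrow> 0) (at 0)"
      by (rule Lim_transform_eventually[OF flat_tendsto_0[of "[:0, 1:] * p"]])
        (auto simp: flat_def divide_inverse eventually_at_filter)
    then show ?thesis using 3 by (simp add: has_field_derivative_iff flat_def)
  qed
qed

lemma flat_one_pos: "0 < t \<Longrightarrow> 0 < flat 1 t" and flat_one_nonneg: "0 \<le> flat 1 t"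
  by (auto simp: flat_def)

text \<open>The denominator of the usual smooth step, treated as a generator of its own: its
  derivative is a polynomial in itself and flat functions. At least one of t and 1 - t is positive,
  so it never divides by zero.\<close>

definition recip :: "real \<Rightarrow> real" where
  "recip t = inverse (flat 1 t + flat 1 (1 - t))"

lemma flat_sum_pos: "0 < flat 1 t + flat 1 (1 - t)"
  using flat_one_pos[of t] flat_one_pos[of "1 - t"] flat_one_nonneg[of t] flat_one_nonneg[of "1 - t"]
  by (cases "0 < t") auto

lemma recip_has_derivative:
  "(recip has_real_derivative
     - (flat (flat_deriv 1) t - flat (flat_deriv 1) (1 - t)) * recip t * recip t) (at t)"
proof -
  have "((\<lambda>t. flat 1 (1 - t)) has_real_derivative flat (flat_deriv 1) (1 - t) * (0 - 1)) (at t)"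
    by (rule DERIV_chain'[OF _ flat_has_derivative]) (intro derivative_intros)
  then have "((\<lambda>t. inverse (flat 1 t + flat 1 (1 - t))) has_real_derivative
     - (inverse (flat 1 t + flat 1 (1 - t)) * (flat (flat_deriv 1) t + flat (flat_deriv 1) (1 - t) * (0 - 1))
       * inverse (flat 1 t + flat 1 (1 - t)))) (at t)"
    using flat_sum_pos[of t] by (intro DERIV_inverse' DERIV_add flat_has_derivative) auto
  then show ?thesis unfolding recip_def[abs_def] by (simp add: algebra_simps)
qed

definition step :: "real \<Rightarrow> real" where "step t = flat 1 t * recip t"

definition eta :: "real \<Rightarrow> real" where
  "eta t = flat (flat_deriv 1) t * recip t +
    flat 1 t * (- (flat (flat_deriv 1) t - flat (flat_deriv 1) (1 - t)) * recip t * recip t)"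

lemma step_has_derivative: "(step has_real_derivative eta t) (at t)"
  unfolding step_def[abs_def] eta_def
  by (rule DERIV_cong[OF DERIV_mult[OF flat_has_derivative recip_has_derivative]]) simp

lemma step_le_0: "t \<le> 0 \<Longrightarrow> step t = 0"
  by (simp add: step_def flat_def)

lemma step_ge_1: "1 \<le> t \<Longrightarrow> step t = 1"
  using flat_one_pos[of t] by (simp add: step_def recip_def) (simp add: flat_def)

lemma step_bounds: "0 \<le> step t" "step t \<le> 1"
  using flat_one_nonneg[of t] flat_one_nonneg[of "1 - t"] flat_sum_pos[of t]
  by (auto simp: step_def recip_def field_simps)

text \<open>The quotient rule for A/(A + B) as (A'B - AB')/(A + B)^2, with B the reflection of A. In
  this form both the sign and the support in the unit interval are visible.\<close>

lemma eta_eq: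
  "eta t = (flat (flat_deriv 1) t * flat 1 (1 - t) + flat 1 t * flat (flat_deriv 1) (1 - t)) * (recip t)\<^sup>2"
proof -
  have "1 = (flat 1 t + flat 1 (1 - t)) * recip t"
    using flat_sum_pos[of t] by (simp add: recip_def)
  then have "q * recip t * 1 = q * recip t * ((flat 1 t + flat 1 (1 - t)) * recip t)" for q
    by (rule arg_cong)
  then have eq: "q * recip t = q * flat 1 t * recip t * recip t + q * flat 1 (1 - t) * recip t * recip t" for q
    by (simp add: algebra_simps)
  show ?thesis
    unfolding eta_def eq[of "flat (flat_deriv 1) t"] by (simp add: algebra_simps power2_eq_square)
qed

lemma eta_pos: "0 < t \<Longrightarrow> t < 1 \<Longrightarrow> 0 < eta t"
  unfolding eta_eq using flat_sum_pos[of t]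
  by (intro mult_pos_pos add_pos_pos) (auto simp: flat_def flat_deriv_def recip_def pderiv_1 power2_eq_square)

lemma eta_nonzero: "eta t \<noteq> 0 \<Longrightarrow> 0 < t \<and> t < 1"
  unfolding eta_eq by (auto simp: flat_def split: if_splits)

lemma eta_nonneg: "0 \<le> eta t"
  using eta_pos[of t] eta_nonzero[of t] by fastforce

lemma continuous_flat: "continuous_on S (flat p)"
  by (meson DERIV_isCont continuous_at_imp_continuous_on flat_has_derivative)

lemma continuous_eta: "continuous_on S eta"
proof -
  have "continuous_on S recip"
    by (meson DERIV_isCont continuous_at_imp_continuous_on recip_has_derivative)
  moreover have "continuous_on S (\<lambda>t. flat p (1 - t))" for p
    by (rule continuous_on_compose2[OF continuous_flat[of UNIV]]) (auto intro: continuous_intros)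
  ultimately show ?thesis
    unfolding eta_def[abs_def] by (intro continuous_intros continuous_flat)
qed

lemma eta_bounded: "\<exists>B\<ge>1. \<forall>t. eta t \<le> B"
proof -
  have "bounded (eta ` {0..1})"
    by (intro compact_imp_bounded compact_continuous_image continuous_eta) auto
  then obtain B where "\<forall>x\<in>eta ` {0..1}. norm x \<le> B"
    unfolding bounded_iff by blast
  then have B: "norm (eta t) \<le> B" if "t \<in> {0..1}" for t using that by blast
  have "eta t \<le> max 1 B" for t
    using B[of t] eta_nonzero[of t] by (cases "eta t = 0") auto
  then show ?thesis by (intro exI[of _ "max 1 B"]) auto
qed

text \<open>A class of functions containing all its own directional derivatives. Membership
  therefore gives differentiability of every iterated derivative, as \<open>smooth_fun\<close>
  demands.\<close>

inductive_set smooth_alg :: "(real^'k::finite \<Rightarrow> real) set" where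
  const: "(\<lambda>x. c) \<in> smooth_alg"
| flat: "(\<lambda>x. flat p (a * x $ i + b)) \<in> smooth_alg"
| recip: "(\<lambda>x. recip (a * x $ i + b)) \<in> smooth_alg"
| add: "\<phi> \<in> smooth_alg \<Longrightarrow> \<psi> \<in> smooth_alg \<Longrightarrow> (\<lambda>x. \<phi> x + \<psi> x) \<in> smooth_alg"
| mult: "\<phi> \<in> smooth_alg \<Longrightarrow> \<psi> \<in> smooth_alg \<Longrightarrow> (\<lambda>x. \<phi> x * \<psi> x) \<in> smooth_alg"

lemma smooth_alg_diff: "\<phi> \<in> smooth_alg \<Longrightarrow> \<psi> \<in> smooth_alg \<Longrightarrow> (\<lambda>x. \<phi> x - \<psi> x) \<in> smooth_alg"
  using smooth_alg.add[OF _ smooth_alg.mult[OF smooth_alg.const[of "-1"]]] by simp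

lemma smooth_alg_prod: "finite A \<Longrightarrow> (\<And>j. j \<in> A \<Longrightarrow> \<phi> j \<in> smooth_alg) \<Longrightarrow> (\<lambda>x. \<Prod>j\<in>A. \<phi> j x) \<in> smooth_alg"
proof (induction rule: finite_induct)
  case empty
  show ?case using smooth_alg.const[of 1] by simp
next
  case (insert j A)
  then show ?case using smooth_alg.mult[of "\<phi> j" "\<lambda>x. \<Prod>j\<in>A. \<phi> j x"] by simp
qed

lemma smooth_alg_flat_flip: "(\<lambda>x. flat p (1 - (a * x $ i + b))) \<in> smooth_alg"
proof -
  have eq: "1 - (a * t + b) = (- a) * t + (1 - b)" for t by simp
  show ?thesis unfolding eq by (rule smooth_alg.flat)
qed

lemma has_derivative_affine_component:
  assumes "(h has_real_derivative d) (at (a * x $ i + b))"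
  shows "((\<lambda>x :: real^'k::finite. h (a * x $ i + b)) has_derivative (\<lambda>v. d * a * v $ i)) (at x)"
proof -
  have 1: "((\<lambda>x :: real^'k. a * x $ i + b) has_derivative (\<lambda>v. a * v $ i)) (at x)"
    by (auto intro!: derivative_eq_intros bounded_linear.has_derivative[OF bounded_linear_vec_nth])
  show ?thesis
    using has_derivative_compose[OF 1 assms[unfolded has_field_derivative_def]] by (simp add: mult.assoc)
qed

lemma smooth_alg_has_derivative:
  assumes "\<phi> \<in> smooth_alg"
  shows "\<exists>D. (\<forall>x. (\<phi> has_derivative D x) (at x)) \<and> (\<forall>v. (\<lambda>x. D x v) \<in> smooth_alg)"
  using assms
proof induction
  case (const c)
  then show ?case by (intro exI[of _ "\<lambda>x v. 0"]) (auto intro: smooth_alg.const)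
next
  case (flat p a i b)
  have "(\<lambda>x. flat (flat_deriv p) (a * x $ i + b) * (a * v $ i)) \<in> smooth_alg" for v
    by (intro smooth_alg.intros)
  then show ?case
    using has_derivative_affine_component[OF flat_has_derivative]
    by (intro exI[of _ "\<lambda>x v. flat (flat_deriv p) (a * x $ i + b) * a * v $ i"]) (auto simp: mult.assoc)
next
  case (recip a i b)
  let ?d = "\<lambda>t. - (flat (flat_deriv 1) t - flat (flat_deriv 1) (1 - t)) * recip t * recip t"
  have "(\<lambda>x. ((-1) * (flat (flat_deriv 1) (a * x $ i + b) - flat (flat_deriv 1) (1 - (a * x $ i + b))))
      * recip (a * x $ i + b) * recip (a * x $ i + b) * (a * v $ i)) \<in> smooth_alg" for v
    by (intro smooth_alg.mult smooth_alg_diff smooth_alg_flat_flip smooth_alg.flat smooth_alg.recip smooth_alg.const)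
  then have "(\<lambda>x. ?d (a * x $ i + b) * a * v $ i) \<in> smooth_alg" for v
    by (simp add: mult.assoc)
  then show ?case
    using has_derivative_affine_component[OF recip_has_derivative]
    by (intro exI[of _ "\<lambda>x v. ?d (a * x $ i + b) * a * v $ i"]) auto
next
  case (add \<phi> \<psi>)
  then obtain D E where "\<forall>x. (\<phi> has_derivative D x) (at x)" "\<forall>v. (\<lambda>x. D x v) \<in> smooth_alg"
    "\<forall>x. (\<psi> has_derivative E x) (at x)" "\<forall>v. (\<lambda>x. E x v) \<in> smooth_alg" by blast
  then show ?case
    by (intro exI[of _ "\<lambda>x v. D x v + E x v"]) (auto intro: has_derivative_add smooth_alg.add)
next
  case (mult \<phi> \<psi>)
  then obtain D E where "\<forall>x. (\<phi> has_derivative D x) (at x)" "\<forall>v. (\<lambda>x. D x v) \<in> smooth_alg"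
    "\<forall>x. (\<psi> has_derivative E x) (at x)" "\<forall>v. (\<lambda>x. E x v) \<in> smooth_alg" by blast
  then show ?case using mult.hyps
    by (intro exI[of _ "\<lambda>x v. \<phi> x * E x v + D x v * \<psi> x"] conjI allI
        has_derivative_mult smooth_alg.add smooth_alg.mult) auto
qed

lemma smooth_alg_differentiable: "\<phi> \<in> smooth_alg \<Longrightarrow> \<phi> differentiable (at x)"
  using smooth_alg_has_derivative unfolding differentiable_def by blast

lemma smooth_alg_directional:
  assumes "\<phi> \<in> smooth_alg" shows "(\<lambda>x. frechet_derivative \<phi> (at x) v) \<in> smooth_alg"
proof -
  obtain D where D: "\<forall>x. (\<phi> has_derivative D x) (at x)" "\<forall>v. (\<lambda>x. D x v) \<in> smooth_alg"
    using smooth_alg_has_derivative[OF assms] by blast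
  then have "frechet_derivative \<phi> (at x) = D x" for x
    by (metis frechet_derivative_at)
  then show ?thesis using D(2) by simp
qed

lemma smooth_alg_smooth: "\<phi> \<in> smooth_alg \<Longrightarrow> smooth_fun \<phi>"
proof -
  assume \<phi>: "\<phi> \<in> smooth_alg"
  have "iter_deriv \<phi> vs \<in> smooth_alg" for vs
    by (induction vs) (auto simp: \<phi> intro: smooth_alg_directional)
  then show ?thesis
    unfolding smooth_fun_def using smooth_alg_differentiable by blast
qed

section \<open>Product bumps and their comparison by weak derivatives\<close>

definition ramp :: "real \<Rightarrow> real \<Rightarrow> real \<Rightarrow> real" where
  "ramp a l t = step ((t - a) / l)"

definition prof :: "real \<Rightarrow> real \<Rightarrow> real \<Rightarrow> real" where
  "prof a l t = eta ((t - a) / l) / l"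

text \<open>The weight lives on the box with corner \<open>a\<close> and side lengths
  \<open>l\<close>. The sides are kept separate so that a cube can be deformed into another one
  coordinate at a time.\<close>

definition bump :: "('k \<Rightarrow> real) \<Rightarrow> ('k \<Rightarrow> real) \<Rightarrow> real^'k::finite \<Rightarrow> real" where
  "bump a l x = (\<Prod>j\<in>UNIV. prof (a j) (l j) (x $ j))"

lemma scaled_eq: "(t - a) / l = (1 / l) * t + (- a / l)" for t a l :: real
  by (simp add: diff_divide_distrib)

lemma ramp_has_derivative: "(ramp a l has_real_derivative prof a l t) (at t)"
proof -
  have "((\<lambda>t. step ((t - a) / l)) has_real_derivative eta ((t - a) / l) * (1 / l)) (at t)"
    by (intro DERIV_chain'[OF _ step_has_derivative] DERIV_cdivide) (auto intro!: derivative_eq_intros)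
  then show ?thesis by (simp add: ramp_def[abs_def] prof_def)
qed

lemma prof_nonneg: "0 < l \<Longrightarrow> 0 \<le> prof a l t"
  by (simp add: prof_def eta_nonneg)

lemma prof_nonzero: "0 < l \<Longrightarrow> prof a l t \<noteq> 0 \<Longrightarrow> a < t \<and> t < a + l"
  using eta_nonzero[of "(t - a) / l"] by (auto simp: prof_def field_simps)

text \<open>Every ramp is 0 before and 1 after its transition, so two ramps differ only between.
  This supplies compact support for the primitive of a difference of profiles.\<close>

lemma ramp_diff_nonzero:
  assumes "0 < l" "0 < l'" "ramp a l t \<noteq> ramp a' l' t" "A \<le> a" "A \<le> a'" "a + l \<le> B" "a' + l' \<le> B"
  shows "A < t \<and> t < B"
proof (rule ccontr)
  assume "\<not> ?thesis"
  then consider "t \<le> A" | "B \<le> t" by linarith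
  then show False
  proof cases
    case 1
    then have "(t - a) / l \<le> 0" "(t - a') / l' \<le> 0" using assms by (auto simp: divide_le_0_iff)
    then show ?thesis using assms(3) by (simp add: ramp_def step_le_0)
  next
    case 2
    then have "1 \<le> (t - a) / l" "1 \<le> (t - a') / l'" using assms by (auto simp: field_simps)
    then show ?thesis using assms(3) by (simp add: ramp_def step_ge_1)
  qed
qed

lemma ramp_diff_le_1: "\<bar>ramp a l t - ramp a' l' t\<bar> \<le> 1"
  unfolding ramp_def using step_bounds[of "(t - a) / l"] step_bounds[of "(t - a') / l'"] by linarith

lemma ramp_smooth: "(\<lambda>x. ramp a l (x $ i)) \<in> smooth_alg"
  unfolding ramp_def step_def scaled_eq by (intro smooth_alg.intros)

lemma prof_smooth: "(\<lambda>x. prof a l (x $ i)) \<in> smooth_alg"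
proof -
  have eq: "prof a l t = (1 / l) * (flat (flat_deriv 1) ((t - a) / l) * recip ((t - a) / l) +
    flat 1 ((t - a) / l) * ((-1) * (flat (flat_deriv 1) ((t - a) / l) - flat (flat_deriv 1) (1 - (t - a) / l))
      * recip ((t - a) / l) * recip ((t - a) / l)))" for t
    by (simp add: prof_def eta_def)
  show ?thesis
    unfolding eq unfolding scaled_eq
    by (intro smooth_alg.mult smooth_alg.add smooth_alg_diff smooth_alg_flat_flip smooth_alg.flat
        smooth_alg.recip smooth_alg.const)
qed

lemma smooth_alg_continuous: "\<phi> \<in> smooth_alg \<Longrightarrow> continuous_on S \<phi>"
  by (meson continuous_at_imp_continuous_on differentiable_imp_continuous_within smooth_alg_differentiable)

lemma bump_continuous: "continuous_on S (bump a l)"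
  unfolding bump_def[abs_def] by (intro smooth_alg_continuous smooth_alg_prod prof_smooth) simp

lemma bump_nonneg: "(\<And>j. 0 < l j) \<Longrightarrow> 0 \<le> bump a l x"
  unfolding bump_def by (intro prod_nonneg ballI prof_nonneg)

lemma bump_nonzero: "(\<And>j. 0 < l j) \<Longrightarrow> bump a l x \<noteq> 0 \<Longrightarrow> a j < x $ j \<and> x $ j < a j + l j"
  unfolding bump_def using prof_nonzero[of "l j" "a j" "x $ j"] by auto

text \<open>The difference of two bumps with different profiles in a single coordinate is a partial
  derivative of a test function, because both profiles have integral one.\<close>

definition shift :: "('k \<Rightarrow> real) \<Rightarrow> ('k \<Rightarrow> real) \<Rightarrow> 'k \<Rightarrow> real \<Rightarrow> real \<Rightarrow> real^'k::finite \<Rightarrow> real" where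
  "shift a l i b r x = (ramp b r (x $ i) - ramp (a i) (l i) (x $ i)) *
     (\<Prod>j\<in>UNIV - {i}. prof (a j) (l j) (x $ j))"

lemma shift_smooth: "shift a l i b r \<in> smooth_alg"
  unfolding shift_def[abs_def]
  by (intro smooth_alg.mult smooth_alg_diff ramp_smooth smooth_alg_prod prof_smooth) simp

lemma shift_nonzero:
  assumes "\<And>j. 0 < l j" "0 < r" "\<And>j. A j \<le> a j \<and> a j + l j \<le> B j" "A i \<le> b" "b + r \<le> B i"
    and "shift a l i b r x \<noteq> 0"
  shows "A j < x $ j \<and> x $ j < B j"
proof (cases "j = i")
  case True
  have "ramp b r (x $ i) \<noteq> ramp (a i) (l i) (x $ i)" using assms(6) by (auto simp: shift_def)
  then show ?thesis
    using ramp_diff_nonzero[OF assms(2,1), of b "x $ i" "a i" i "A i" "B i"] assms True by auto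
next
  case False
  then have "prof (a j) (l j) (x $ j) \<noteq> 0" using assms(6) by (auto simp: shift_def)
  then show ?thesis using prof_nonzero[OF assms(1)] assms(3)[of j] by fastforce
qed

lemma shift_bound:
  assumes "\<And>t. eta t \<le> M" "\<And>j. 0 < r0 \<and> r0 \<le> l j"
  shows "\<bar>shift a l i b r (x :: real^'k::finite)\<bar> \<le> (M / r0) ^ (CARD('k) - 1)"
proof -
  have prof: "0 \<le> prof a' (l j) t" "prof a' (l j) t \<le> M / r0" for a' j t
  proof -
    show "0 \<le> prof a' (l j) t" using assms(2)[of j] by (intro prof_nonneg) linarith
    have "0 \<le> M" using assms(1)[of 0] eta_nonneg[of 0] by linarith
    then show "prof a' (l j) t \<le> M / r0"
      unfolding prof_def using assms(1) assms(2)[of j] by (intro frac_le) auto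
  qed
  have "\<bar>shift a l i b r x\<bar> \<le> 1 * (\<Prod>j\<in>UNIV - {i}. M / r0)"
    unfolding shift_def abs_mult
  proof (rule mult_mono)
    have "\<bar>\<Prod>j\<in>UNIV - {i}. prof (a j) (l j) (x $ j)\<bar> = (\<Prod>j\<in>UNIV - {i}. prof (a j) (l j) (x $ j))"
      using prof by (intro abs_of_nonneg prod_nonneg) auto
    also have "\<dots> \<le> (\<Prod>j\<in>UNIV - {i}. M / r0)" using prof by (intro prod_mono) auto
    finally show "\<bar>\<Prod>j\<in>UNIV - {i}. prof (a j) (l j) (x $ j)\<bar> \<le> (\<Prod>j\<in>UNIV - {i}. M / r0)" .
  qed (auto intro: ramp_diff_le_1)
  then show ?thesis by simp
qed

lemma shift_partial_deriv:
  "partial_deriv i (shift a l i b r) x = bump (a(i := b)) (l(i := r)) x - bump a l x"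
proof -
  let ?\<phi> = "shift a l i b r" and ?P = "\<Prod>j\<in>UNIV - {i}. prof (a j) (l j) (x $ j)"
  let ?e = "axis i 1 :: real^'a"
  \<comment> \<open>The partial derivative is computed along the line through \<open>x\<close> in
    direction \<open>i\<close>, where only the difference of ramps varies.\<close>
  have "(?\<phi> has_derivative frechet_derivative ?\<phi> (at x)) (at x)"
    using smooth_alg_differentiable[OF shift_smooth] by (simp add: frechet_derivative_works)
  then have "(?\<phi> has_derivative frechet_derivative ?\<phi> (at x)) (at (x + 0 *\<^sub>R ?e))" by simp
  moreover have "((\<lambda>s. x + s *\<^sub>R ?e) has_derivative (\<lambda>s. s *\<^sub>R ?e)) (at 0)"
    by (auto intro!: derivative_eq_intros)
  ultimately have "((\<lambda>s. ?\<phi> (x + s *\<^sub>R ?e)) has_derivative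
      (\<lambda>s. frechet_derivative ?\<phi> (at x) (s *\<^sub>R ?e))) (at 0)"
    by (rule has_derivative_compose[rotated])
  moreover have "frechet_derivative ?\<phi> (at x) (s *\<^sub>R ?e) = partial_deriv i ?\<phi> x * s" for s
    using linear_frechet_derivative[OF smooth_alg_differentiable[OF shift_smooth], of a l i b r x]
    by (simp add: partial_deriv_def linear_cmul mult.commute)
  ultimately have 1: "((\<lambda>s. ?\<phi> (x + s *\<^sub>R ?e)) has_real_derivative partial_deriv i ?\<phi> x) (at 0)"
    by (simp add: has_field_derivative_def)
  have "?\<phi> (x + s *\<^sub>R ?e) = (ramp b r (x $ i + s) - ramp (a i) (l i) (x $ i + s)) * ?P" for s
    unfolding shift_def by (auto simp: axis_def intro!: prod.cong)
  moreover have "((\<lambda>s. (ramp b r (x $ i + s) - ramp (a i) (l i) (x $ i + s)) * ?P) has_real_derivative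
      (prof b r (x $ i) - prof (a i) (l i) (x $ i)) * ?P) (at 0)"
  proof -
    have "((\<lambda>s. ramp a' l' (x $ i + s)) has_real_derivative prof a' l' (x $ i)) (at 0)" for a' l'
      using ramp_has_derivative[of a' l' "x $ i"] DERIV_shift[of "ramp a' l'" _ 0 "x $ i"]
      by (simp add: add.commute)
    then show ?thesis by (intro DERIV_cmult_right DERIV_diff)
  qed
  ultimately have "((\<lambda>s. ?\<phi> (x + s *\<^sub>R ?e)) has_real_derivative
      (prof b r (x $ i) - prof (a i) (l i) (x $ i)) * ?P) (at 0)" by simp
  from DERIV_unique[OF 1 this] have "partial_deriv i ?\<phi> x = prof b r (x $ i) * ?P - prof (a i) (l i) (x $ i) * ?P"
    by (simp add: algebra_simps)
  also have "prof (a i) (l i) (x $ i) * ?P = bump a l x"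
    unfolding bump_def by (rule prod.remove[symmetric]) auto
  also have "prof b r (x $ i) * ?P = bump (a(i := b)) (l(i := r)) x"
  proof -
    have "bump (a(i := b)) (l(i := r)) x = prof b r (x $ i) *
        (\<Prod>j\<in>UNIV - {i}. prof ((a(i := b)) j) ((l(i := r)) j) (x $ j))"
      unfolding bump_def by (subst prod.remove[of _ i]) auto
    also have "(\<Prod>j\<in>UNIV - {i}. prof ((a(i := b)) j) ((l(i := r)) j) (x $ j)) = ?P"
      by (intro prod.cong) auto
    finally show ?thesis ..
  qed
  finally show ?thesis .
qed

lemma integrable_continuous_bounded_support:
  fixes h :: "real^'k::finite \<Rightarrow> 'b::euclidean_space"
  assumes "continuous_on UNIV h" "\<And>x. h x \<noteq> 0 \<Longrightarrow> x \<in> cbox u v"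
  shows "integrable lebesgue h"
proof -
  have "integrable lborel (\<lambda>x. indicator (cbox u v) x *\<^sub>R h x)"
    by (rule borel_integrable_compact) (auto intro: continuous_on_subset[OF assms(1)])
  moreover have "indicator (cbox u v) x *\<^sub>R h x = h x" for x
    using assms(2)[of x] by (auto simp: indicator_def)
  ultimately have "integrable lborel h" by simp
  then show ?thesis using integrable_completion borel_measurable_continuous_onI[OF assms(1)]
    by (metis measurable_lborel2)
qed

lemma bump_integrable:
  fixes f :: "real^'k::finite \<Rightarrow> 'b::euclidean_space"
  assumes "\<And>j. 0 < l j" "continuous_on UNIV f"
  shows "integrable lebesgue (\<lambda>x. bump a l x *\<^sub>R f x)"
proof (rule integrable_continuous_bounded_support)
  show "continuous_on UNIV (\<lambda>x. bump a l x *\<^sub>R f x)"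
    by (intro continuous_intros bump_continuous assms)
  fix x assume "bump a l x *\<^sub>R f x \<noteq> 0"
  then have "bump a l x \<noteq> 0" by auto
  from bump_nonzero[OF assms(1) this] show "x \<in> cbox (\<chi> j. a j) (\<chi> j. a j + l j)"
    by (auto simp: mem_box_cart less_imp_le)
qed

text \<open>The definition of the weak derivative, tested with \<open>shift\<close>, turns the
  difference of the two weighted integrals into an integral of \<open>g\<close> against a function
  bounded by \<open>shift_bound\<close>.\<close>

lemma shift_estimate:
  fixes f g :: "real^'k::finite \<Rightarrow> 'b::euclidean_space"
  assumes l: "\<And>j. 0 < r0 \<and> r0 \<le> l j" and r: "r0 \<le> r"
    and box: "\<And>j. A j \<le> a j \<and> a j + l j \<le> B j" "A i \<le> b" "b + r \<le> B i"
    and f: "continuous_on UNIV f" and weak: "weak_partial i f g"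
    and Q: "\<And>x. (\<And>j. A j < x $ j \<and> x $ j < B j) \<Longrightarrow> x \<in> Q" "Q \<in> sets lebesgue"
    and g: "g \<in> borel_measurable lebesgue" "integrable lebesgue (\<lambda>x. indicator Q x * norm (g x))"
    and M: "\<And>t. eta t \<le> M"
  shows "norm ((\<integral>x. bump (a(i := b)) (l(i := r)) x *\<^sub>R f x \<partial>lebesgue) - (\<integral>x. bump a l x *\<^sub>R f x \<partial>lebesgue))
    \<le> (M / r0) ^ (CARD('k) - 1) * (\<integral>x. indicator Q x * norm (g x) \<partial>lebesgue)"
proof -
  let ?\<phi> = "shift a l i b r" and ?C = "(M / r0) ^ (CARD('k) - 1)"
  have r0: "0 < r" and l0: "0 < l j" for j using l[of j] r by linarith+
  have supp: "A j < x $ j \<and> x $ j < B j" if "?\<phi> x \<noteq> 0" for x j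
    by (rule shift_nonzero[where A = A and B = B, OF l0 r0 box that])
  have "closure {x. ?\<phi> x \<noteq> 0} \<subseteq> cbox (\<chi> j. A j) (\<chi> j. B j)"
    using supp by (intro closure_minimal) (auto simp: mem_box_cart less_imp_le)
  then have "compact (closure {x. ?\<phi> x \<noteq> 0})"
    by (meson bounded_cbox bounded_subset closed_closure compact_eq_bounded_closed)
  then have test: "test_function ?\<phi>"
    unfolding test_function_def using smooth_alg_smooth[OF shift_smooth] by blast
  have bound: "norm (?\<phi> x *\<^sub>R g x) \<le> ?C * (indicator Q x * norm (g x))" for x
  proof (cases "?\<phi> x = 0")
    case True
    have "0 \<le> M" using M[of 0] eta_nonneg[of 0] by linarith
    then show ?thesis using True l[of i] by simp
  next
    case False
    then have "x \<in> Q" using supp Q(1) by blast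
    then show ?thesis using shift_bound[of M r0 l a i b r x] M l by (auto intro: mult_right_mono)
  qed
  have meas: "(\<lambda>x. ?\<phi> x *\<^sub>R g x) \<in> borel_measurable lebesgue"
  proof -
    have "?\<phi> \<in> borel_measurable borel"
      by (intro borel_measurable_continuous_onI smooth_alg_continuous shift_smooth)
    then have "?\<phi> \<in> borel_measurable lebesgue"
      by (intro measurable_completion) (simp add: measurable_lborel2)
    then show ?thesis using g(1) by measurable
  qed
  have int: "integrable lebesgue (\<lambda>x. ?C * (indicator Q x * norm (g x)))"
    by (intro integrable_mult_right g)
  have "(\<integral>x. bump (a(i := b)) (l(i := r)) x *\<^sub>R f x \<partial>lebesgue) - (\<integral>x. bump a l x *\<^sub>R f x \<partial>lebesgue)
      = (\<integral>x. bump (a(i := b)) (l(i := r)) x *\<^sub>R f x - bump a l x *\<^sub>R f x \<partial>lebesgue)"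
    using l0 r0 by (intro Bochner_Integration.integral_diff[symmetric] bump_integrable f) auto
  also have "\<dots> = (\<integral>x. partial_deriv i ?\<phi> x *\<^sub>R f x \<partial>lebesgue)"
    by (simp add: shift_partial_deriv scaleR_diff_left)
  also have "\<dots> = - (\<integral>x. ?\<phi> x *\<^sub>R g x \<partial>lebesgue)"
    using weak test by (simp add: weak_partial_def)
  also have "norm \<dots> \<le> (\<integral>x. norm (?\<phi> x *\<^sub>R g x) \<partial>lebesgue)"
    unfolding norm_minus_cancel by (rule integral_norm_bound)
  also have "\<dots> \<le> (\<integral>x. ?C * (indicator Q x * norm (g x)) \<partial>lebesgue)"
    using bound by (intro integral_mono integrable_norm Bochner_Integration.integrable_bound[OF int meas] int)
      (auto intro: order_trans[OF _ abs_ge_self])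
  finally show ?thesis by simp
qed

text \<open>Stands in for Poincare's inequality: two bumps inside one box are compared without
  approximating f by smooth functions.\<close>

lemma bump_change_estimate:
  fixes f :: "real^'k::finite \<Rightarrow> 'b::euclidean_space" and g :: "'k \<Rightarrow> real^'k \<Rightarrow> 'b"
  assumes l: "\<And>j. 0 < r0 \<and> r0 \<le> l j" and l': "\<And>j. r0 \<le> l' j"
    and box: "\<And>j. A j \<le> a j \<and> a j + l j \<le> B j" "\<And>j. A j \<le> a' j \<and> a' j + l' j \<le> B j"
    and f: "continuous_on UNIV f" and weak: "\<And>i. weak_partial i f (g i)"
    and Q: "\<And>x. (\<And>j. A j < x $ j \<and> x $ j < B j) \<Longrightarrow> x \<in> Q" "Q \<in> sets lebesgue"
    and g: "\<And>i. g i \<in> borel_measurable lebesgue" "\<And>i. integrable lebesgue (\<lambda>x. indicator Q x * norm (g i x))"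
    and M: "\<And>t. eta t \<le> M"
  shows "norm ((\<integral>x. bump a' l' x *\<^sub>R f x \<partial>lebesgue) - (\<integral>x. bump a l x *\<^sub>R f x \<partial>lebesgue))
    \<le> (\<Sum>i\<in>UNIV. (M / r0) ^ (CARD('k) - 1) * (\<integral>x. indicator Q x * norm (g i x) \<partial>lebesgue))"
proof -
  \<comment> \<open>Hybrid boxes: coordinates in \<open>S\<close> are already those of the target.
    Adding one coordinate to \<open>S\<close> is one use of \<open>shift_estimate\<close>.\<close>
  define \<alpha> where "\<alpha> S j = (if j \<in> S then a' j else a j)" for S j
  define \<beta> where "\<beta> S j = (if j \<in> S then l' j else l j)" for S j
  let ?I = "\<lambda>S. \<integral>x. bump (\<alpha> S) (\<beta> S) x *\<^sub>R f x \<partial>lebesgue"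
  let ?E = "\<lambda>i. (M / r0) ^ (CARD('k) - 1) * (\<integral>x. indicator Q x * norm (g i x) \<partial>lebesgue)"
  have "norm (?I S - ?I {}) \<le> (\<Sum>i\<in>S. ?E i)" for S
    using finite[of S]
  proof (induction S rule: finite_induct)
    case (insert i S)
    have upd: "\<alpha> (insert i S) = (\<alpha> S)(i := a' i)" "\<beta> (insert i S) = (\<beta> S)(i := l' i)"
      by (auto simp: \<alpha>_def \<beta>_def)
    have "norm (?I (insert i S) - ?I S) \<le> ?E i"
      unfolding upd using l l' box
      by (intro shift_estimate[where A = A and B = B] f weak Q g M) (auto simp: \<alpha>_def \<beta>_def)
    then have "norm (?I (insert i S) - ?I {}) \<le> ?E i + (\<Sum>i\<in>S. ?E i)"
      using insert.IH norm_triangle_ineq[of "?I (insert i S) - ?I S" "?I S - ?I {}"] by simp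
    then show ?case using insert.hyps by simp
  qed simp
  from this[of UNIV] show ?thesis by (simp add: \<alpha>_def[abs_def] \<beta>_def[abs_def])
qed

subsection \<open>Sobolev functions\<close>

definition corner :: "nat \<Rightarrow> real^'k::finite \<Rightarrow> 'k \<Rightarrow> real" where
  "corner k x j = real_of_int (dkey k x j) / 2 ^ k"

lemma mem_dcube_iff: "y \<in> dcube k x \<longleftrightarrow> (\<forall>j. corner k x j \<le> y $ j \<and> y $ j < corner k x j + (1/2) ^ k)"
proof -
  have "dkey k y j = dkey k x j \<longleftrightarrow> corner k x j \<le> y $ j \<and> y $ j < corner k x j + (1/2) ^ k" for j
    unfolding dkey_def[of k y] corner_def by (auto simp: floor_eq_iff field_simps power_one_over)
  then show ?thesis by (auto simp: dcube_def fun_eq_iff)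
qed

text \<open>The half-open cube lies between an open and a closed box of equal volume.\<close>

lemma emeasure_dcube:
  fixes x :: "real^'k::finite"
  shows "emeasure lebesgue (dcube k x) = ennreal ((1/2) ^ (k * CARD('k)))"
proof -
  let ?a = "\<chi> j. corner k x j" and ?b = "\<chi> j. corner k x j + (1/2) ^ k"
  have prod: "(\<Prod>b\<in>Basis. (?b - ?a) \<bullet> b) = (1/2) ^ (k * CARD('k))"
  proof -
    have "(?b - ?a) \<bullet> b = (1/2) ^ k" if "b \<in> Basis" for b
      using that by (auto simp: Basis_vec_def inner_axis)
    then show ?thesis by (simp add: power_mult)
  qed
  have le: "?a \<bullet> b \<le> ?b \<bullet> b" if "b \<in> Basis" for b
    using that by (auto simp: Basis_vec_def inner_axis)
  have Q: "dcube k x \<in> sets lborel" by simp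
  have "emeasure lborel (box ?a ?b) \<le> emeasure lborel (dcube k x)"
    by (rule emeasure_mono) (auto simp: mem_dcube_iff mem_box_cart less_imp_le Q)
  moreover have "emeasure lborel (dcube k x) \<le> emeasure lborel (cbox ?a ?b)"
    by (rule emeasure_mono) (auto simp: mem_dcube_iff mem_box_cart less_imp_le)
  ultimately show ?thesis
    using le prod Q by (simp add: emeasure_lborel_box emeasure_lborel_cbox)
qed

lemma measure_dcube: "measure lebesgue (dcube k (x :: real^'k::finite)) = (1/2) ^ (k * CARD('k))"
  using emeasure_dcube[of k x] by (simp add: measure_def)

lemma bump_continuous_meas: "bump a l \<in> borel_measurable borel"
  by (intro borel_measurable_continuous_onI bump_continuous)

text \<open>The affine substitution shows that bumps of all positions and sizes have the same
  integral, so one normalising constant serves every level.\<close>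

lemma bump_scale:
  fixes a :: "'k::finite \<Rightarrow> real"
  assumes "0 < r"
  shows "(\<integral>x. bump a (\<lambda>_. r) x \<partial>lebesgue) = (\<integral>x. bump (\<lambda>_::'k. 0) (\<lambda>_. 1) x \<partial>lebesgue)"
proof -
  let ?t = "\<chi> j. a j"
  have eq: "r ^ CARD('k) * bump a (\<lambda>_. r) (?t + r *\<^sub>R x) = bump (\<lambda>_. 0) (\<lambda>_. 1) x" for x
  proof -
    have "bump a (\<lambda>_. r) (?t + r *\<^sub>R x) = (\<Prod>j\<in>UNIV. eta (x $ j) / r)"
      using assms unfolding bump_def by (intro prod.cong) (auto simp: prof_def)
    then show ?thesis using assms by (simp add: prod_dividef bump_def prof_def)
  qed
  have [measurable]: "bump a (\<lambda>_. r) \<in> borel_measurable borel" by (rule bump_continuous_meas)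
  have "(\<integral>x. bump a (\<lambda>_. r) x \<partial>lborel)
      = (\<integral>x. bump a (\<lambda>_. r) x \<partial>density (distr lborel borel (\<lambda>x. ?t + r *\<^sub>R x)) (\<lambda>_. ennreal (\<bar>r\<bar> ^ DIM(real^'k))))"
    using assms by (subst lborel_affine[of r ?t]) (auto simp: ennreal_power)
  also have "\<dots> = (\<integral>x. r ^ CARD('k) * bump a (\<lambda>_. r) (?t + r *\<^sub>R x) \<partial>lborel)"
    using assms by (subst integral_real_density) (auto simp: integral_distr)
  finally show ?thesis
    by (simp add: eq integral_completion bump_continuous_meas)
qed

lemma bump_mass_pos: "0 < (\<integral>x. bump (\<lambda>_. 0) (\<lambda>_. 1) (x :: real^'k::finite) \<partial>lebesgue)" (is "0 < ?I")
proof -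
  let ?\<phi> = "bump (\<lambda>_. 0) (\<lambda>_. 1) :: real^'k \<Rightarrow> real"
  have nn: "0 \<le> ?\<phi> x" for x by (rule bump_nonneg) simp
  have int: "integrable lebesgue ?\<phi>"
    using bump_integrable[of "\<lambda>_. 1" "\<lambda>_. 1 :: real" "\<lambda>_. 0"] by simp
  have "?I \<noteq> 0"
  proof
    assume "?I = 0"
    then have "AE x in lebesgue. ?\<phi> x = 0"
      using integral_nonneg_eq_0_iff_AE[OF int] nn by simp
    then obtain N where "{x. ?\<phi> x \<noteq> 0} \<subseteq> N" "N \<in> null_sets lebesgue"
      by (auto simp: eventually_ae_filter)
    then have "negligible {x. ?\<phi> x \<noteq> 0}"
      using negligible_subset negligible_iff_null_sets by blast
    moreover have "open {x. ?\<phi> x \<noteq> 0}"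
      by (intro open_Collect_neq bump_continuous continuous_intros)
    moreover have "?\<phi> (\<chi> j. 1/2) \<noteq> 0"
      using eta_pos[of "1/2"] by (simp add: bump_def prof_def)
    ultimately show False using open_not_negligible by blast
  qed
  moreover have "0 \<le> ?I" using nn by simp
  ultimately show ?thesis by simp
qed

text \<open>Plays the part of Jensen's inequality at the price of a factor 2, by integrating the
  pointwise bound h <= t + h^m / t^(m-1).\<close>

lemma integral_le_by_power_integral:
  fixes h :: "'a \<Rightarrow> real"
  assumes Q: "Q \<in> fmeasurable M" and h: "h \<in> borel_measurable M" "\<And>x. 0 \<le> h x"
    and int: "integrable M (\<lambda>x. indicator Q x * h x ^ m)"
    and m: "0 < m" and t: "0 < t" and le: "(\<integral>x. indicator Q x * h x ^ m \<partial>M) \<le> t ^ m * measure M Q"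
  shows "integrable M (\<lambda>x. indicator Q x * h x)" "(\<integral>x. indicator Q x * h x \<partial>M) \<le> 2 * t * measure M Q"
proof -
  have pt: "h x \<le> t + h x ^ m / t ^ (m - 1)" for x
  proof (cases "h x \<le> t")
    case False
    have "h x * t ^ (m - 1) \<le> h x * h x ^ (m - 1)"
      using False t h(2)[of x] by (intro mult_left_mono power_mono) auto
    also have "\<dots> = h x ^ m" using m by (simp add: power_eq_if)
    finally have "h x \<le> h x ^ m / t ^ (m - 1)" using t by (simp add: field_simps)
    then show ?thesis using t by simp
  qed (use h t in \<open>simp add: add_increasing2\<close>)
  let ?B = "\<lambda>x. t * indicator Q x + (indicator Q x * h x ^ m) / t ^ (m - 1)"
  have intQ: "integrable M (\<lambda>x. indicator Q x :: real)"
    using Q by (auto simp: fmeasurable_def)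
  have intB: "integrable M ?B" using int intQ by auto
  have le': "indicator Q x * h x \<le> ?B x" for x
    using pt[of x] by (auto simp: indicator_def)
  have [measurable]: "h \<in> borel_measurable M" "Q \<in> sets M" using h Q by auto
  show i: "integrable M (\<lambda>x. indicator Q x * h x)"
  proof (rule Bochner_Integration.integrable_bound[OF intB])
    have "norm (indicator Q x * h x) \<le> norm (?B x)" for x
      using le'[of x] h(2)[of x] by (simp add: abs_mult)
    then show "AE x in M. norm (indicator Q x * h x) \<le> norm (?B x)" by simp
  qed measurable
  have "(\<integral>x. indicator Q x * h x \<partial>M) \<le> (\<integral>x. ?B x \<partial>M)"
    by (rule integral_mono[OF i intB]) (rule le')
  also have "\<dots> = t * measure M Q + (\<integral>x. indicator Q x * h x ^ m \<partial>M) / t ^ (m - 1)"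
    using int intQ Q by (subst Bochner_Integration.integral_add) (auto simp: fmeasurable_def)
  also have "\<dots> \<le> t * measure M Q + t ^ m * measure M Q / t ^ (m - 1)"
    using le t by (intro add_left_mono divide_right_mono) auto
  also have "t ^ m * measure M Q / t ^ (m - 1) = t * measure M Q"
  proof -
    have "t ^ m = t ^ (m - 1) * t" by (rule power_minus_mult[OF m, symmetric])
    then show ?thesis using t by simp
  qed
  finally show "(\<integral>x. indicator Q x * h x \<partial>M) \<le> 2 * t * measure M Q" by simp
qed

text \<open>Open sets of Lebesgue measure tending to 0 shrink to a null set, which stays null for
  the density; continuity from above does the rest.\<close>

lemma null_set_outer_open_density:
  fixes W :: "'a::euclidean_space \<Rightarrow> real"
  assumes N: "N \<in> null_sets lebesgue" and W: "integrable lebesgue W" "\<And>x. 0 \<le> W x" and \<epsilon>: "0 < \<epsilon>"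
  shows "\<exists>G. open G \<and> N \<subseteq> G \<and> emeasure (density lebesgue (\<lambda>x. ennreal (1 + W x))) G \<le> ennreal \<epsilon>"
proof -
  let ?M = "density lebesgue (\<lambda>x. ennreal (1 + W x))"
  have [measurable]: "W \<in> borel_measurable lebesgue" using W by auto
  have NL: "N \<in> sets lebesgue" using N by auto
  have "\<forall>j. \<exists>T. open T \<and> N \<subseteq> T \<and> emeasure lebesgue (T - N) < ennreal (1 / Suc j)"
    using sets_lebesgue_outer_open[OF NL] by (metis of_nat_0_less_iff zero_less_Suc zero_less_divide_1_iff)
  then obtain T where T: "\<And>j. open (T j)" "\<And>j. N \<subseteq> T j" "\<And>j. emeasure lebesgue (T j - N) < ennreal (1 / Suc j)"
    by metis
  have TL: "T j \<in> sets lebesgue" for j using T(1) by auto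
  have Tm: "emeasure lebesgue (T j) \<le> ennreal (1 / Suc j)" for j
  proof -
    have "emeasure lebesgue (T j) = emeasure lebesgue (T j - N)"
      by (rule emeasure_Diff_null_set[OF N TL, symmetric])
    then show ?thesis using T(3)[of j] by simp
  qed
  \<comment> \<open>Running intersections make the sequence decreasing and keep the sets
    open.\<close>
  define G where "G j = (\<Inter>i\<le>j. T i)" for j
  have G: "open (G j)" "N \<subseteq> G j" "G j \<in> sets lebesgue" for j
    unfolding G_def using T by (auto intro!: open_INT)
  have Gm: "emeasure lebesgue (G j) \<le> ennreal (1 / Suc j)" for j
    using emeasure_mono[of "G j" "T j" lebesgue] Tm[of j] TL by (auto simp: G_def intro: order_trans)
  have fin: "emeasure ?M (G j) \<noteq> \<infinity>" for j
  proof -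
    have "emeasure ?M (G j) = (\<integral>\<^sup>+x. ennreal (1 + W x) * indicator (G j) x \<partial>lebesgue)"
      using G by (intro emeasure_density) auto
    also have "\<dots> \<le> (\<integral>\<^sup>+x. indicator (G j) x + ennreal (W x) \<partial>lebesgue)"
      using W by (intro nn_integral_mono) (auto simp: indicator_def ennreal_plus)
    also have "\<dots> = emeasure lebesgue (G j) + (\<integral>\<^sup>+x. ennreal (W x) \<partial>lebesgue)"
      by (subst nn_integral_add) (simp_all add: G(3) borel_measurable_indicator)
    also have "\<dots> < \<infinity>"
    proof -
      have "emeasure lebesgue (G j) < \<infinity>" using Gm[of j] by (rule le_less_trans) simp
      moreover have "(\<integral>\<^sup>+x. ennreal (W x) \<partial>lebesgue) < \<infinity>"
        using W by (simp add: integrable_iff_bounded)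
      ultimately show ?thesis by simp
    qed
    finally show ?thesis by simp
  qed
  have "(\<lambda>j. emeasure ?M (G j)) \<longlonglongrightarrow> emeasure ?M (\<Inter>j. G j)"
    using G fin by (intro Lim_emeasure_decseq) (auto simp: decseq_def G_def)
  moreover have "emeasure ?M (\<Inter>j. G j) = 0"
  proof -
    have "emeasure lebesgue (\<Inter>j. G j) \<le> ennreal (1 / Suc j)" for j
      using emeasure_mono[of "\<Inter>j. G j" "G j" lebesgue] Gm[of j] G(3) by (auto intro: order_trans)
    then have "emeasure lebesgue (\<Inter>j. G j) \<le> ennreal e" if "0 < e" for e
      using nat_approx_posE[OF that] by (metis ennreal_leI less_imp_le order_trans)
    then have "emeasure lebesgue (\<Inter>j. G j) = 0"
      by (metis add_0 ennreal_le_epsilon le_zero_eq)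
    then have "(\<Inter>j. G j) \<in> null_sets lebesgue" using G(3) by (auto intro!: null_setsI sets.countable_INT)
    then have "(\<Inter>j. G j) \<in> null_sets ?M"
      using absolutely_continuousI_density[of "\<lambda>x. ennreal (1 + W x)" lebesgue] by (auto simp: absolutely_continuous_def)
    then show ?thesis by auto
  qed
  ultimately have "\<forall>\<^sub>F j in sequentially. emeasure ?M (G j) < ennreal \<epsilon>"
    using \<epsilon> by (intro order_tendstoD(2)) auto
  then obtain j where "emeasure ?M (G j) < ennreal \<epsilon>" by (auto simp: eventually_sequentially)
  then show ?thesis using G by (intro exI[of _ "G j"]) (auto intro: less_imp_le)
qed

lemma corner_Suc:
  "corner k x j \<le> corner (Suc k) x j"
  "corner (Suc k) x j + (1/2) ^ Suc k \<le> corner k x j + (1/2) ^ k"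
proof -
  have "dkey k x j = dkey (Suc k) x j div 2"
    using floor_divide_real_eq_div[of 2 "2 ^ Suc k * x $ j"] by (simp add: dkey_def)
  then have "2 * dkey k x j \<le> dkey (Suc k) x j" "dkey (Suc k) x j + 1 \<le> 2 * dkey k x j + 2" by linarith+
  then have le: "2 * real_of_int (dkey k x j) \<le> dkey (Suc k) x j"
    "real_of_int (dkey (Suc k) x j) + 1 \<le> 2 * real_of_int (dkey k x j) + 2" by linarith+
  have "2 * real_of_int (dkey k x j) / 2 ^ Suc k \<le> dkey (Suc k) x j / 2 ^ Suc k"
    by (rule divide_right_mono[OF le(1)]) simp
  moreover have "(real_of_int (dkey (Suc k) x j) + 1) / 2 ^ Suc k \<le> (2 * real_of_int (dkey k x j) + 2) / 2 ^ Suc k"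
    by (rule divide_right_mono[OF le(2)]) simp
  ultimately show "corner k x j \<le> corner (Suc k) x j"
    "corner (Suc k) x j + (1/2) ^ Suc k \<le> corner k x j + (1/2) ^ k"
    by (simp_all add: corner_def add_divide_distrib power_one_over)
qed

section \<open>Hoelder continuous Sobolev functions satisfy the dyadic assumptions\<close>

locale holder_sobolev =
  fixes f :: "real^'n::finite \<Rightarrow> real^'m::finite" and g :: "'n \<Rightarrow> real^'n \<Rightarrow> real^'m" and \<alpha> H :: real
  assumes card_le: "CARD('m) \<le> CARD('n)"
    and \<alpha>: "0 < \<alpha>" "\<alpha> \<le> 1" and H: "0 \<le> H"
    and holder: "\<And>x y. dist (f x) (f y) \<le> H * dist x y powr \<alpha>"
    and weak: "\<And>i. weak_partial i f (g i)"
    and g_meas: "\<And>i. g i \<in> borel_measurable lebesgue"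
    and g_int: "\<And>i. integrable lebesgue (\<lambda>x. norm (g i x) ^ CARD('m))"
begin

lemma f_continuous: "continuous_on UNIV f"
proof -
  have "\<exists>d>0. \<forall>y. dist y x < d \<longrightarrow> dist (f y) (f x) < e" if e: "0 < e" for x e
  \<comment> \<open>\<open>H + 1\<close> avoids a division by zero when f is constant.\<close>
  proof (intro exI[of _ "(e / (H + 1)) powr (1 / \<alpha>)"] conjI allI impI)
    have pos: "0 < e / (H + 1)" and "H + 1 \<noteq> 0" using e H by auto
    then show "0 < (e / (H + 1)) powr (1 / \<alpha>)" using e by simp
    fix y assume "dist y x < (e / (H + 1)) powr (1 / \<alpha>)"
    then have "dist y x powr \<alpha> \<le> ((e / (H + 1)) powr (1 / \<alpha>)) powr \<alpha>"
      using \<alpha> by (intro powr_mono2) auto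
    also have "\<dots> = e / (H + 1)" using e H \<alpha> by (auto simp: powr_powr)
    finally have "dist (f y) (f x) \<le> H * (e / (H + 1))"
      using holder[of y x] H by (meson mult_left_mono order_trans)
    also have "\<dots> < (H + 1) * (e / (H + 1))" using pos by (intro mult_strict_right_mono) auto
    also have "\<dots> = e" using \<open>H + 1 \<noteq> 0\<close> by simp
    finally show "dist (f y) (f x) < e" .
  qed
  then show ?thesis by (simp add: continuous_on_iff)
qed

definition W :: "real^'n \<Rightarrow> real" where "W x = (\<Sum>i\<in>UNIV. norm (g i x) ^ CARD('m))"
definition M :: "(real^'n) measure" where "M = density lebesgue (\<lambda>x. ennreal (1 + W x))"

lemma W_nonneg: "0 \<le> W x" by (simp add: W_def sum_nonneg)

lemma W_integrable: "integrable lebesgue W"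
  unfolding W_def[abs_def] by (intro Bochner_Integration.integrable_sum g_int)

lemma dcube_lebesgue: "dcube k x \<in> sets lebesgue"
  using dcube_borel by simp

lemma integrable_dcube:
  fixes h :: "real^'n \<Rightarrow> real"
  assumes "integrable lebesgue h"
  shows "integrable lebesgue (\<lambda>y. indicator (dcube k x) y * h y)"
  using integrable_mult_indicator[OF dcube_lebesgue assms] by simp

lemma emeasure_M_dcube:
  "emeasure M (dcube k x) = ennreal ((1/2) ^ (k * CARD('n)) + (\<integral>y. indicator (dcube k x) y * W y \<partial>lebesgue))"
proof -
  have [measurable]: "W \<in> borel_measurable lebesgue" using W_integrable by auto
  have "emeasure M (dcube k x) = (\<integral>\<^sup>+y. ennreal (1 + W y) * indicator (dcube k x) y \<partial>lebesgue)"
    unfolding M_def by (intro emeasure_density dcube_lebesgue) measurable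
  also have "\<dots> = (\<integral>\<^sup>+y. indicator (dcube k x) y + ennreal (indicator (dcube k x) y * W y) \<partial>lebesgue)"
    using W_nonneg by (intro nn_integral_cong) (auto simp: indicator_def ennreal_plus)
  also have "\<dots> = emeasure lebesgue (dcube k x) + (\<integral>\<^sup>+y. ennreal (indicator (dcube k x) y * W y) \<partial>lebesgue)"
    using dcube_lebesgue[of k x] integrable_dcube[OF W_integrable, of k x]
    by (subst nn_integral_add) (auto intro: borel_measurable_indicator)
  also have "(\<integral>\<^sup>+y. ennreal (indicator (dcube k x) y * W y) \<partial>lebesgue) = ennreal (\<integral>y. indicator (dcube k x) y * W y \<partial>lebesgue)"
    using W_nonneg by (intro nn_integral_eq_integral integrable_dcube W_integrable) auto
  finally show ?thesis
    using W_nonneg by (simp add: emeasure_dcube ennreal_plus)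
qed

lemma measure_M_dcube:
  "measure M (dcube k x) = (1/2) ^ (k * CARD('n)) + (\<integral>y. indicator (dcube k x) y * W y \<partial>lebesgue)"
  unfolding measure_def emeasure_M_dcube using W_nonneg by (intro enn2real_ennreal) simp

lemma dcube_fmeasurable: "dcube k x \<in> fmeasurable M"
proof (rule fmeasurableI)
  show "dcube k x \<in> sets M" unfolding M_def using dcube_lebesgue by simp
qed (simp add: emeasure_M_dcube)

lemma measure_M_dcube_ge: "(1/2) ^ (k * CARD('n)) \<le> measure M (dcube k x)"
  unfolding measure_M_dcube using W_nonneg by simp

lemma integral_power_le:
  "(\<integral>y. indicator (dcube k x) y * norm (g i y) ^ CARD('m) \<partial>lebesgue) \<le> measure M (dcube k x)"
proof -
  have "norm (g i y) ^ CARD('m) \<le> W y" for y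
    unfolding W_def by (rule member_le_sum) auto
  then have "(\<integral>y. indicator (dcube k x) y * norm (g i y) ^ CARD('m) \<partial>lebesgue)
      \<le> (\<integral>y. indicator (dcube k x) y * W y \<partial>lebesgue)"
    by (intro integral_mono integrable_dcube g_int W_integrable mult_left_mono) auto
  then show ?thesis unfolding measure_M_dcube by (simp add: add_increasing)
qed

lemma measure_M_sum:
  assumes "finite \<D>" "disjoint \<D>" "\<D> \<subseteq> range (case_prod dcube)" "\<Union>\<D> \<subseteq> dcube k x"
  shows "(\<Sum>D\<in>\<D>. measure M D) \<le> measure M (dcube k x)"
proof -
  have fm: "D \<in> fmeasurable M" if "D \<in> \<D>" for D
    using that assms(3) dcube_fmeasurable by auto
  have "(\<Sum>D\<in>\<D>. measure M D) = measure M (\<Union>\<D>)"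
    using assms fm by (intro measure_Union'[symmetric]) (auto simp: pairwise_def disjoint_def disjnt_def)
  also have "\<dots> \<le> measure M (dcube k x)"
    using assms fm dcube_fmeasurable by (intro measure_mono_fmeasurable sets.finite_Union) auto
  finally show ?thesis .
qed

definition I :: real where "I = (\<integral>x. bump (\<lambda>_. 0) (\<lambda>_. 1) (x :: real^'n) \<partial>lebesgue)"

text \<open>A mean with a smooth weight instead of the plain mean over the cube, so that passing to
  the next level can be tested against weak derivatives.\<close>

definition avg :: "nat \<Rightarrow> real^'n \<Rightarrow> real^'m" where
  "avg k x = (1 / I) *\<^sub>R (\<integral>y. bump (corner k x) (\<lambda>_. (1/2) ^ k) y *\<^sub>R f y \<partial>lebesgue)"

lemma I_pos: "0 < I" unfolding I_def by (rule bump_mass_pos)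

lemma avg_close: "norm (f x - avg k x) \<le> max 1 (H * CARD('n) powr \<alpha>) * 2 powr (- \<alpha> * k)"
proof -
  let ?b = "bump (corner k x) (\<lambda>_. (1/2) ^ k)"
  let ?B = "H * (CARD('n) * (1/2) ^ k) powr \<alpha>"
  have int: "integrable lebesgue (\<lambda>y. ?b y *\<^sub>R h y)" if "continuous_on UNIV h" for h :: "real^'n \<Rightarrow> 'b::euclidean_space"
    using that by (intro bump_integrable) auto
  have b_int: "integrable lebesgue ?b" using int[of "\<lambda>_. 1::real"] by simp
  have b_nn: "0 \<le> ?b y" for y by (rule bump_nonneg) simp
  have I: "(\<integral>y. ?b y \<partial>lebesgue) = I" unfolding I_def by (rule bump_scale) simp
  have "I *\<^sub>R (f x - avg k x) = (\<integral>y. ?b y *\<^sub>R f x \<partial>lebesgue) - (\<integral>y. ?b y *\<^sub>R f y \<partial>lebesgue)"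
    using I_pos I b_int by (simp add: avg_def scaleR_diff_right)
  also have "\<dots> = (\<integral>y. ?b y *\<^sub>R (f x - f y) \<partial>lebesgue)"
    using int[OF continuous_on_const] int[OF f_continuous]
    by (subst Bochner_Integration.integral_diff[symmetric]) (auto simp: scaleR_diff_right)
  finally have "I * norm (f x - avg k x) = norm (\<integral>y. ?b y *\<^sub>R (f x - f y) \<partial>lebesgue)"
    using I_pos by (metis abs_of_pos norm_scaleR)
  also have "\<dots> \<le> (\<integral>y. norm (?b y *\<^sub>R (f x - f y)) \<partial>lebesgue)" by (rule integral_norm_bound)
  also have "\<dots> \<le> (\<integral>y. ?b y * ?B \<partial>lebesgue)"
  proof (rule integral_mono)
    show "integrable lebesgue (\<lambda>y. norm (?b y *\<^sub>R (f x - f y)))"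
      by (intro integrable_norm int continuous_intros f_continuous)
    show "integrable lebesgue (\<lambda>y. ?b y * ?B)" using b_int by simp
    fix y
    show "norm (?b y *\<^sub>R (f x - f y)) \<le> ?b y * ?B"
    proof (cases "?b y = 0")
      case False
      have "y \<in> dcube k x"
        unfolding mem_dcube_iff using bump_nonzero[OF _ False] by (simp add: less_imp_le)
      then have "dist y x \<le> CARD('n) * (1/2) ^ k" by (rule dcube_dist)
      then have "dist x y powr \<alpha> \<le> (CARD('n) * (1/2) ^ k) powr \<alpha>"
        using \<alpha> by (intro powr_mono2) (auto simp: dist_commute)
      then have "norm (f x - f y) \<le> ?B"
        using holder[of x y] H by (metis dist_norm mult_left_mono order_trans)
      then show ?thesis using b_nn[of y] by (simp add: mult_left_mono)
    qed simp
  qed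
  also have "\<dots> = I * ?B" using I by simp
  finally have "norm (f x - avg k x) \<le> ?B" using I_pos by simp
  also have "?B = H * CARD('n) powr \<alpha> * 2 powr (- \<alpha> * k)"
  proof -
    have "(1/2::real) ^ k = 2 powr (- real k)"
      by (simp add: powr_minus powr_realpow power_one_over inverse_eq_divide)
    then show ?thesis by (simp add: powr_mult powr_powr mult_ac)
  qed
  also have "\<dots> \<le> max 1 (H * CARD('n) powr \<alpha>) * 2 powr (- \<alpha> * k)"
    by (intro mult_right_mono) auto
  finally show ?thesis .
qed

text \<open>The bump of the child cube lies in the parent cube, so
  \<open>bump_change_estimate\<close> applies with the parent as box. The powers of the side length
  cancel except for one factor, the gain of Poincare's inequality.\<close>

lemma avg_step:
  fixes B :: real
  assumes B: "\<And>t. eta t \<le> B"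
  shows "norm (avg k x - avg (Suc k) x) ^ CARD('m)
    \<le> (1 / I * (CARD('n) * ((2 * B) ^ (CARD('n) - 1) * 2))) ^ CARD('m)
      * 2 ^ (k * (CARD('n) - CARD('m))) * measure M (dcube k x)"
proof -
  let ?Q = "dcube k x" and ?r = "(1/2::real) ^ k" and ?L = "(1/2::real) ^ (k * CARD('n))"
  let ?J = "\<lambda>k. \<integral>y. bump (corner k x) (\<lambda>_. (1/2) ^ k) y *\<^sub>R f y \<partial>lebesgue"
  \<comment> \<open>The m-th power of \<open>t\<close> is the mean density of the measure on the
    cube, hence \<open>t\<close> bounds the mean size of each weak derivative up to the factor
    2.\<close>
  define t where "t = root CARD('m) (measure M ?Q / ?L)"
  have \<mu>: "0 < measure M ?Q" by (rule less_le_trans[OF _ measure_M_dcube_ge]) simp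
  have t: "0 < t" "t ^ CARD('m) = measure M ?Q / ?L"
    using \<mu> by (auto simp: t_def)
  have Q: "?Q \<in> fmeasurable lebesgue"
    using dcube_lebesgue by (intro fmeasurableI) (auto simp: emeasure_dcube)
  have B0: "0 \<le> B" using B[of 0] eta_nonneg[of 0] by linarith
  have gL: "integrable lebesgue (\<lambda>y. indicator ?Q y * norm (g i y))"
    "(\<integral>y. indicator ?Q y * norm (g i y) \<partial>lebesgue) \<le> 2 * t * ?L" for i
  proof -
    have 1: "(\<lambda>y. norm (g i y)) \<in> borel_measurable lebesgue" using g_meas by measurable
    have 2: "(\<integral>y. indicator ?Q y * norm (g i y) ^ CARD('m) \<partial>lebesgue) \<le> t ^ CARD('m) * measure lebesgue ?Q"
      using integral_power_le[of k x i] t by (simp add: measure_dcube)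
    note * = integral_le_by_power_integral[OF Q 1 norm_ge_zero integrable_dcube[OF g_int] _ t(1) 2]
    show "integrable lebesgue (\<lambda>y. indicator ?Q y * norm (g i y))" using * by simp
    show "(\<integral>y. indicator ?Q y * norm (g i y) \<partial>lebesgue) \<le> 2 * t * ?L"
      using *(2) by (simp add: measure_dcube)
  qed
  have "norm (?J (Suc k) - ?J k) \<le> (\<Sum>i\<in>UNIV. (B / (1/2) ^ Suc k) ^ (CARD('n) - 1) * (\<integral>y. indicator ?Q y * norm (g i y) \<partial>lebesgue))"
  proof (rule bump_change_estimate[where A = "corner k x" and B = "\<lambda>j. corner k x j + ?r"])
    show "y \<in> ?Q" if "\<And>j. corner k x j < y $ j \<and> y $ j < corner k x j + ?r" for y
      unfolding mem_dcube_iff using that by (simp add: less_imp_le)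
    show "corner k x j \<le> corner (Suc k) x j \<and> corner (Suc k) x j + (1/2) ^ Suc k \<le> corner k x j + ?r" for j
      using corner_Suc by blast
  qed (auto intro: f_continuous weak dcube_lebesgue g_meas gL B)
  also have "\<dots> \<le> (\<Sum>i\<in>(UNIV::'n set). (B / (1/2) ^ Suc k) ^ (CARD('n) - 1) * (2 * t * ?L))"
    using gL(2) B0 by (intro sum_mono mult_left_mono) auto
  also have "\<dots> = CARD('n) * ((2 * B / ?r) ^ (CARD('n) - 1) * (2 * t * ?L))"
    by (simp add: mult_ac)
  also have "?L = ?r ^ (CARD('n) - 1) * ?r"
    unfolding power_mult by (rule power_minus_mult[symmetric]) simp
  also have "CARD('n) * ((2 * B / ?r) ^ (CARD('n) - 1) * (2 * t * (?r ^ (CARD('n) - 1) * ?r)))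
      = CARD('n) * ((2 * B) ^ (CARD('n) - 1) * 2) * (t * ?r)"
  proof -
    have "(y / r) ^ p * (2 * t * (r ^ p * r)) = y ^ p * 2 * (t * r)" if "r \<noteq> 0" for y r :: real and p
      using that by (simp add: power_divide)
    from this[of ?r "2 * B" "CARD('n) - 1"] show ?thesis by (simp only: mult.assoc) simp
  qed
  finally have J: "norm (?J (Suc k) - ?J k) \<le> CARD('n) * ((2 * B) ^ (CARD('n) - 1) * 2) * (t * ?r)" .
  have "norm (avg k x - avg (Suc k) x) = 1 / I * norm (?J (Suc k) - ?J k)"
    using I_pos by (simp add: avg_def norm_minus_commute flip: scaleR_diff_right)
  also have "\<dots> \<le> 1 / I * (CARD('n) * ((2 * B) ^ (CARD('n) - 1) * 2) * (t * ?r))"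
    using J I_pos by (intro mult_left_mono) auto
  also have "\<dots> = 1 / I * (CARD('n) * ((2 * B) ^ (CARD('n) - 1) * 2)) * (t * ?r)"
    by (simp only: mult.assoc)
  finally have "norm (avg k x - avg (Suc k) x) ^ CARD('m)
      \<le> (1 / I * (CARD('n) * ((2 * B) ^ (CARD('n) - 1) * 2)) * (t * ?r)) ^ CARD('m)"
    by (rule power_mono) simp
  also have "\<dots> = (1 / I * (CARD('n) * ((2 * B) ^ (CARD('n) - 1) * 2))) ^ CARD('m)
      * (t ^ CARD('m) * ?r ^ CARD('m))"
    by (simp only: power_mult_distrib)
  \<comment> \<open>Dividing by the volume 2^(-kn) and multiplying by 2^(-km) leaves the factor
    2^(k(n-m)).\<close>
  also have "t ^ CARD('m) * ?r ^ CARD('m) = 2 ^ (k * (CARD('n) - CARD('m))) * measure M ?Q"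
  proof -
    have "k * CARD('n) = k * CARD('m) + k * (CARD('n) - CARD('m))"
      using card_le by (metis add_mult_distrib2 le_add_diff_inverse)
    then have "?r ^ CARD('m) = 2 ^ (k * (CARD('n) - CARD('m))) * ?L"
      by (simp add: power_add power_mult[symmetric] power_one_over)
    then show ?thesis using t(2) by simp
  qed
  finally show ?thesis by (simp only: mult.assoc)
qed

lemma telescope: "\<exists>C1 C2. dyadic_telescope f avg (measure M) \<alpha> C1 C2"
proof -
  obtain B where B: "1 \<le> B" "\<And>t. eta t \<le> B" using eta_bounded by blast
  have "dyadic_telescope f avg (measure M) \<alpha> (max 1 (H * CARD('n) powr \<alpha>))
    ((1 / I * (CARD('n) * ((2 * B) ^ (CARD('n) - 1) * 2))) ^ CARD('m))"
  proof
    show "avg k y = avg k x" if "y \<in> dcube k x" for k x y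
    proof -
      have "corner k y = corner k x"
        using that by (auto simp: corner_def dcube_def fun_eq_iff)
      then show ?thesis by (simp add: avg_def)
    qed
    show "0 < (1 / I * (CARD('n) * ((2 * B) ^ (CARD('n) - 1) * 2))) ^ CARD('m)"
      using I_pos B by simp
  qed (use card_le \<alpha> avg_close avg_step[OF B(2)] measure_M_dcube_ge measure_M_sum in auto)
  then show ?thesis by blast
qed

lemma hausdorff_null_graph:
  fixes h :: "real^'n \<Rightarrow> 'b::metric_space"
  assumes N: "N \<in> null_sets lebesgue" and h: "\<And>x y. dist (h x) (h y) \<le> dist x y + dist (f x) (f y)"
  shows "hausdorff_measure CARD('n) (h ` N) = 0"
proof -
  obtain C1 C2 where "dyadic_telescope f avg (measure M) \<alpha> C1 C2" using telescope by blast
  then interpret dyadic_telescope f avg "measure M" \<alpha> C1 C2 .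
  show ?thesis
  proof (rule hausdorff_null[where M = M])
    show "sets M = sets lebesgue" by (simp add: M_def)
    show "emeasure M (dcube k x) = ennreal (measure M (dcube k x))" for k x
      unfolding emeasure_M_dcube measure_M_dcube ..
    show "\<exists>G. open G \<and> N \<subseteq> G \<and> emeasure M G \<le> ennreal \<epsilon>" if "0 < \<epsilon>" for \<epsilon>
      unfolding M_def by (rule null_set_outer_open_density[OF N W_integrable W_nonneg that])
  qed (rule h)
qed

end

theorem theorem8p3:
  fixes f :: "real^'n \<Rightarrow> real^'m" and N :: "(real^'n) set"
    and V :: "((real^'n) \<times> (real^'m)) set"
  assumes "CARD('m) \<le> CARD('n)"
    and "sobolev_1 CARD('m) f"
    and "holder_continuous f"
    and "N \<in> null_sets lebesgue"
    and "V \<in> grassmannian CARD('n)"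
  shows "hausdorff_measure CARD('n) ((orth_proj V \<circ> (\<lambda>x. (x, f x))) ` N) = 0"
proof -
  obtain g where g: "\<And>i. Lp_space CARD('m) (g i)" "\<And>i. weak_partial i f (g i)"
    using assms(2) unfolding sobolev_1_def by metis
  obtain \<alpha> C where \<alpha>: "0 < \<alpha>" "\<alpha> \<le> 1" and C: "\<And>x y. dist (f x) (f y) \<le> C * dist x y powr \<alpha>"
    using assms(3) unfolding holder_continuous_def by blast
  \<comment> \<open>The definition of Hoelder continuity puts no sign on its constant, while the
    locale asks for a nonnegative one.\<close>
  have H: "dist (f x) (f y) \<le> max C 0 * dist x y powr \<alpha>" for x y
    by (rule order_trans[OF C]) (intro mult_right_mono, auto)
  interpret holder_sobolev f g \<alpha> "max C 0"
    using assms(1) \<alpha> H g unfolding Lp_space_def by unfold_locales auto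
  have V: "subspace V" using assms(5) by (simp add: grassmannian_def)
  show ?thesis
  proof (rule hausdorff_null_graph[OF assms(4)])
    fix x y
    have "dist (orth_proj V (x, f x)) (orth_proj V (y, f y)) \<le> dist (x, f x) (y, f y)"
      by (rule orth_proj_dist_le[OF V])
    also have "\<dots> \<le> dist x y + dist (f x) (f y)"
      by (simp add: dist_Pair_Pair sqrt_sum_squares_le_sum)
    finally show "dist ((orth_proj V \<circ> (\<lambda>x. (x, f x))) x) ((orth_proj V \<circ> (\<lambda>x. (x, f x))) y)
      \<le> dist x y + dist (f x) (f y)" by simp
  qed
qed

end
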